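(* Apply the construction described in the context to the pointed algebraic variety $(\mathbb G_m,1)$ over $\mathbb Q$ with the semigroup $S=\mathbb N=\mathbb Z_{>0}$ of endomorphisms $u\mapsto u^n$. The result is the Bost--Connes system: there is an isomorphism of $\mathbb Q$-algebras from the inductive limit $A=\varinjlim_n A_n$, where $X_n=\mathrm{Spec}(A_n)$, onto the group ring $\mathbb Q[\mathbb Q/\mathbb Z]$, under which the endomorphisms $\rho_n$ of $A$ given by the construction correspond to the endomorphisms $$\rho_n(e_r)=\frac1n\sum_{ns=r}e_s,\qquad r\in\mathbb Q/\mathbb Z,\ n\in\mathbb N,$$ of $\mathbb Q[\mathbb Q/\mathbb Z]$.
   Context: Construction. Given a pointed algebraic variety $(Y,y_0)$ over a field $\mathbb K$ and a countable unital abelian semigroup $S$ of finite endomorphisms of $(Y,y_0)$, unramified over $y_0$, put $X_s=\{y\in Y:s(y)=y_0\}=\mathrm{Spec}(A_s)$ for $s\in S$, with transition maps $X_{sr}\to X_s$, $y\mapsto r(y)$. Let $X=\varprojlim_sX_s$, with projections $\xi_s$, and let $A=\varinjlim_s A_s$ be the corresponding inductive limit algebra, whose elements are viewed as functions on $X$. Let $X^{e_s}\subset X$ be the open and closed subset of those $x$ with $\xi_s(x)$ in the component of $y_0$ in $X_s$. There are isomorphisms $\beta_s:X\to X^{e_s}$ determined by $\xi_{su}(\beta_s(x))=\xi_u(x)$ for all $u\in S$, $x\in X$, and one defines algebra endomorphisms $\rho_s$ by $\rho_s(f)(x)=f(\beta_s^{-1}(x))$ for $x\in X^{e_s}$ and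 $\rho_s(f)(x)=0$ for $x\notin X^{e_s}$. Bost--Connes system (as an algebraic system over $\mathbb Q$). The algebra is the group ring $\mathbb Q[\mathbb Q/\mathbb Z]=\varinjlim_n\mathbb Q[\mathbb Z/n\mathbb Z]$ with canonical basis $e_r$, $r\in\mathbb Q/\mathbb Z$, and the multiplicative semigroup $\mathbb N=\mathbb Z_{>0}$ acts by the endomorphisms $\rho_n(e_r)=\frac1n\sum_{ns=r}e_s$. *)

theory Defs
  imports
    "HOL-Algebra.QuotRing"
    "HOL-Algebra.Module"
    "HOL-Algebra.Algebraic_Closure_Type"
    "HOL-Analysis.Abstract_Topology_2"
    "HOL-Library.Poly_Mapping"
    "HOL-Library.FuncSet"
begin

section \<open>Algebras and affine schemes\<close>

text \<open>
  A \<open>K\<close>-algebra is a \<open>module\<close> record over a ring record \<open>K\<close>. The affine scheme \<open>Spec R\<close> is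
  represented by \<open>R\<close>: its points are the prime ideals of \<open>R\<close>, its topology is the Zariski
  topology, and a morphism \<open>Spec R \<rightarrow> Spec R'\<close> over \<open>K\<close> is given by its comorphism, a homomorphism
  \<open>R' \<rightarrow> R\<close> of \<open>K\<close>-algebras.
\<close>

definition alg_hom ::
    "('k, 'm) ring_scheme \<Rightarrow> ('k, 'a, 'n) module_scheme \<Rightarrow> ('k, 'b, 'o) module_scheme \<Rightarrow> ('a \<Rightarrow> 'b) set"
  where "alg_hom K R R' = {h \<in> ring_hom R R'.
    \<forall>k\<in>carrier K. \<forall>a\<in>carrier R. h (k \<odot>\<^bsub>R\<^esub> a) = k \<odot>\<^bsub>R'\<^esub> h a}"

definition alg_iso ::
    "('k, 'm) ring_scheme \<Rightarrow> ('k, 'a, 'n) module_scheme \<Rightarrow> ('k, 'b, 'o) module_scheme \<Rightarrow> ('a \<Rightarrow> 'b) set"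
  where "alg_iso K R R' = {h \<in> alg_hom K R R'. bij_betw h (carrier R) (carrier R')}"

definition quot_alg :: "('k, 'a, 'm) module_scheme \<Rightarrow> 'a set \<Rightarrow> ('k, 'a set) module"
  where "quot_alg R I =
    ring.extend (R Quot I) \<lparr>module.smult = \<lambda>k c. \<Union>a\<in>c. I +>\<^bsub>R\<^esub> (k \<odot>\<^bsub>R\<^esub> a)\<rparr>"

definition Spec :: "('a, 'm) ring_scheme \<Rightarrow> 'a set set"
  where "Spec R = {p. primeideal p R}"

definition zariski :: "('a, 'm) ring_scheme \<Rightarrow> 'a set topology"
  where "zariski R = topology_generated_by ((\<lambda>f. {p \<in> Spec R. f \<notin> p}) ` carrier R)"

definition Spec_map :: "('a, 'm) ring_scheme \<Rightarrow> ('a \<Rightarrow> 'b) \<Rightarrow> 'b set \<Rightarrow> 'a set"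
  where "Spec_map R' h p = {a \<in> carrier R'. h a \<in> p}"

text \<open>
  The value \<open>f(x)\<close> of \<open>f \<in> R\<close> at the point \<open>x\<close>, an element of \<open>R/x\<close>, which is contained in the
  residue field of \<open>x\<close>.
\<close>

definition fun_value :: "('a, 'm) ring_scheme \<Rightarrow> 'a \<Rightarrow> 'a set \<Rightarrow> 'a set"
  where "fun_value R f x = x +>\<^bsub>R\<^esub> f"

text \<open>
  \<open>h\<close> is the comorphism of a morphism \<open>Spec R \<rightarrow> Spec R\<close> over \<open>K\<close> that is an isomorphism onto the
  open and closed subscheme \<open>U\<close>. Such a \<open>U\<close> is the locus \<open>e \<noteq> 0\<close> of an idempotent \<open>e\<close>, its ring of
  functions is \<open>eR\<close> (with unit \<open>e\<close>), restriction of functions to \<open>U\<close> is multiplication by \<open>e\<close>, and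
  the morphism is an isomorphism onto \<open>U\<close> iff \<open>h\<close> restricts to a unital isomorphism of \<open>eR\<close> with \<open>R\<close>.
\<close>

definition iso_onto_clopen ::
    "('k, 'm) ring_scheme \<Rightarrow> ('k, 'a, 'n) module_scheme \<Rightarrow> 'a set set \<Rightarrow> ('a \<Rightarrow> 'a) \<Rightarrow> bool"
  where "iso_onto_clopen K R U h \<longleftrightarrow> h \<in> alg_hom K R R \<and>
    (\<exists>e\<in>carrier R. e \<otimes>\<^bsub>R\<^esub> e = e \<and> {x \<in> Spec R. e \<notin> x} = U \<and>
       h e = \<one>\<^bsub>R\<^esub> \<and> bij_betw h ((\<lambda>a. e \<otimes>\<^bsub>R\<^esub> a) ` carrier R) (carrier R))"


section \<open>The construction for a pointed affine variety\<close>

text \<open>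
  The data \<open>(Y, y\<^sub>0)\<close> and \<open>S\<close> with \<open>Y = Spec B\<close> affine: \<open>base\<close> is the field \<open>K\<close>, \<open>coord\<close> is \<open>B\<close>,
  \<open>point\<close> is the \<open>K\<close>-algebra homomorphism \<open>B \<rightarrow> K\<close> of evaluation at \<open>y\<^sub>0\<close>, and \<open>act s\<close> is the
  comorphism \<open>f \<mapsto> f \<circ> s\<close> of the endomorphism \<open>s\<close>. The formulas below make sense without finiteness
  and unramifiedness of the endomorphisms, which serve to make \<open>beta\<close> and \<open>rho\<close> well defined.
\<close>

record ('k, 'b, 's) pointed_system =
  base :: "'k ring"
  coord :: "('k, 'b) module"
  point :: "'b \<Rightarrow> 'k"
  semigrp :: "'s monoid"
  act :: "'s \<Rightarrow> 'b \<Rightarrow> 'b"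

definition point_ideal :: "('k, 'b, 's) pointed_system \<Rightarrow> 'b set"
  where "point_ideal D = a_kernel (coord D) (base D) (point D)"

text \<open>The fibre \<open>X\<^sub>s = {y. s(y) = y\<^sub>0}\<close>, as a closed subscheme of \<open>Y\<close>, and its algebra \<open>A\<^sub>s\<close>.\<close>

definition fibre_ideal :: "('k, 'b, 's) pointed_system \<Rightarrow> 's \<Rightarrow> 'b set"
  where "fibre_ideal D s = Idl\<^bsub>coord D\<^esub> (act D s ` point_ideal D)"

definition fibre_alg :: "('k, 'b, 's) pointed_system \<Rightarrow> 's \<Rightarrow> ('k, 'b set) module"
  where "fibre_alg D s = quot_alg (coord D) (fibre_ideal D s)"

text \<open>The point \<open>y\<^sub>0\<close> of \<open>X\<^sub>s\<close>.\<close>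

definition fibre_base_point :: "('k, 'b, 's) pointed_system \<Rightarrow> 's \<Rightarrow> 'b set set"
  where "fibre_base_point D s =
    (\<lambda>f. fibre_ideal D s +>\<^bsub>coord D\<^esub> f) ` point_ideal D"

text \<open>\<open>trans_map D s r : A\<^sub>s \<rightarrow> A\<^sub>s\<^sub>r\<close> is the comorphism of \<open>X\<^sub>s\<^sub>r \<rightarrow> X\<^sub>s, y \<mapsto> r(y)\<close>.\<close>

definition trans_map :: "('k, 'b, 's) pointed_system \<Rightarrow> 's \<Rightarrow> 's \<Rightarrow> 'b set \<Rightarrow> 'b set"
  where "trans_map D s r c =
    (\<Union>f\<in>c. fibre_ideal D (s \<otimes>\<^bsub>semigrp D\<^esub> r) +>\<^bsub>coord D\<^esub> act D r f)"

text \<open>The class in \<open>A\<close> of an element \<open>a\<close> of \<open>A\<^sub>s\<close>.\<close>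

definition lim_class :: "('k, 'b, 's) pointed_system \<Rightarrow> 's \<Rightarrow> 'b set \<Rightarrow> ('s \<times> 'b set) set"
  where "lim_class D s a = {(t, b). t \<in> carrier (semigrp D) \<and> b \<in> carrier (fibre_alg D t) \<and>
    (\<exists>p\<in>carrier (semigrp D). \<exists>q\<in>carrier (semigrp D).
       s \<otimes>\<^bsub>semigrp D\<^esub> p = t \<otimes>\<^bsub>semigrp D\<^esub> q \<and> trans_map D s p a = trans_map D t q b)}"

text \<open>
  The inductive limit \<open>A\<close>. Any two classes have representatives in a common \<open>A\<^sub>s\<close>; the unions below
  are over all such choices, which yield the same class.
\<close>

definition lim_alg :: "('k, 'b, 's) pointed_system \<Rightarrow> ('k, ('s \<times> 'b set) set) module"
  where "lim_alg D =
    \<lparr>carrier = {lim_class D s a | s a. s \<in> carrier (semigrp D) \<and> a \<in> carrier (fibre_alg D s)},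
     monoid.mult = (\<lambda>U V. \<Union>{lim_class D s (a \<otimes>\<^bsub>fibre_alg D s\<^esub> b) | s a b. (s, a) \<in> U \<and> (s, b) \<in> V}),
     one = lim_class D \<one>\<^bsub>semigrp D\<^esub> \<one>\<^bsub>fibre_alg D \<one>\<^bsub>semigrp D\<^esub>\<^esub>,
     ring.zero = lim_class D \<one>\<^bsub>semigrp D\<^esub> \<zero>\<^bsub>fibre_alg D \<one>\<^bsub>semigrp D\<^esub>\<^esub>,
     add = (\<lambda>U V. \<Union>{lim_class D s (a \<oplus>\<^bsub>fibre_alg D s\<^esub> b) | s a b. (s, a) \<in> U \<and> (s, b) \<in> V}),
     module.smult = (\<lambda>k U. \<Union>{lim_class D s (k \<odot>\<^bsub>fibre_alg D s\<^esub> a) | s a. (s, a) \<in> U})\<rparr>"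

text \<open>
  Since all \<open>X\<^sub>s\<close> are affine, the projective limit \<open>X\<close> is \<open>Spec A\<close>, and the comorphism of the
  projection \<open>\<xi>\<^sub>s\<close> is the canonical map \<open>A\<^sub>s \<rightarrow> A\<close>.
\<close>

definition X_space :: "('k, 'b, 's) pointed_system \<Rightarrow> ('s \<times> 'b set) set set set"
  where "X_space D = Spec (lim_alg D)"

definition xi :: "('k, 'b, 's) pointed_system \<Rightarrow> 's \<Rightarrow> ('s \<times> 'b set) set set \<Rightarrow> 'b set set"
  where "xi D s = Spec_map (fibre_alg D s) (lim_class D s)"

definition X_idem :: "('k, 'b, 's) pointed_system \<Rightarrow> 's \<Rightarrow> ('s \<times> 'b set) set set set"
  where "X_idem D s = {x \<in> X_space D. xi D s x \<in>
    connected_component_of_set (zariski (fibre_alg D s)) (fibre_base_point D s)}"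

text \<open>The comorphism \<open>B \<rightarrow> A\<close> of the composite of \<open>\<xi>\<^sub>s\<close> with the inclusion of \<open>X\<^sub>s\<close> in \<open>Y\<close>.\<close>

definition xi_comorphism :: "('k, 'b, 's) pointed_system \<Rightarrow> 's \<Rightarrow> 'b \<Rightarrow> ('s \<times> 'b set) set"
  where "xi_comorphism D s f = lim_class D s (fibre_ideal D s +>\<^bsub>coord D\<^esub> f)"

text \<open>
  The comorphism of \<open>\<beta>\<^sub>s\<close>. The identity \<open>\<xi>\<^sub>s\<^sub>u(\<beta>\<^sub>s(x)) = \<xi>\<^sub>u(x)\<close> relates a point of \<open>X\<^sub>s\<^sub>u\<close> to one of \<open>X\<^sub>u\<close>
  and is an equality of morphisms \<open>X \<rightarrow> Y\<close>; on the underlying sets of prime ideals alone it would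
  not determine \<open>\<beta>\<^sub>s\<close>. Extensionality only fixes the values of the comorphism outside \<open>A\<close>.
\<close>

definition beta ::
    "('k, 'b, 's) pointed_system \<Rightarrow> 's \<Rightarrow> ('s \<times> 'b set) set \<Rightarrow> ('s \<times> 'b set) set"
  where "beta D s = (THE h. h \<in> extensional (carrier (lim_alg D)) \<and>
    iso_onto_clopen (base D) (lim_alg D) (X_idem D s) h \<and>
    (\<forall>u\<in>carrier (semigrp D). \<forall>f\<in>carrier (coord D).
       h (xi_comorphism D (s \<otimes>\<^bsub>semigrp D\<^esub> u) f) = xi_comorphism D u f))"

text \<open>
  \<open>\<rho>\<^sub>s(f) = g\<close>, where \<open>g(\<beta>\<^sub>s(y)) = f(y)\<close> for \<open>y \<in> X\<close> and \<open>g(x) = 0\<close> for \<open>x \<notin> X\<^bsup>e\<^sub>s\<^esup>\<close>. The residue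
  fields of \<open>\<beta>\<^sub>s(y)\<close> and \<open>y\<close> are identified by \<open>\<beta>\<^sub>s\<close>, whose comorphism takes the class of \<open>g\<close> at
  \<open>\<beta>\<^sub>s(y)\<close> to the class of \<open>beta D s g\<close> at \<open>y\<close>.
\<close>

definition rho ::
    "('k, 'b, 's) pointed_system \<Rightarrow> 's \<Rightarrow> ('s \<times> 'b set) set \<Rightarrow> ('s \<times> 'b set) set"
  where "rho D s f = (THE g. g \<in> carrier (lim_alg D) \<and>
    (\<forall>y\<in>X_space D. fun_value (lim_alg D) (beta D s g) y = fun_value (lim_alg D) f y) \<and>
    (\<forall>x\<in>X_space D - X_idem D s. fun_value (lim_alg D) g x = fun_value (lim_alg D) \<zero>\<^bsub>lim_alg D\<^esub> x))"


section \<open>The multiplicative group over the rationals\<close>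

text \<open>
  Multiplication in \<open>'g \<Rightarrow>\<^sub>0 'k\<close> is convolution, so this type is the monoid algebra of the additive
  monoid \<open>'g\<close>, with basis the elements \<open>Poly_Mapping.single r 1\<close>.
\<close>

definition monoid_alg :: "('k::comm_ring_1, 'g::comm_monoid_add \<Rightarrow>\<^sub>0 'k) module"
  where "monoid_alg = ring.extend ring_of_type_algebra \<lparr>module.smult = \<lambda>k f. Poly_Mapping.single 0 k * f\<rparr>"

text \<open>
  The coordinate ring of \<open>\<G>\<^sub>m\<close> is \<open>\<rat>[t, t\<^sup>-\<^sup>1]\<close>, the group algebra of the integers.
\<close>

definition laurent_eval :: "'k::field \<Rightarrow> (int \<Rightarrow>\<^sub>0 'k) \<Rightarrow> 'k"
  where "laurent_eval u f = (\<Sum>k\<in>Poly_Mapping.keys f. Poly_Mapping.lookup f k * u powi k)"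

definition laurent_power_subst :: "nat \<Rightarrow> (int \<Rightarrow>\<^sub>0 'k::field) \<Rightarrow> (int \<Rightarrow>\<^sub>0 'k)"
  where "laurent_power_subst n f =
    (\<Sum>k\<in>Poly_Mapping.keys f. Poly_Mapping.single (int n * k) (Poly_Mapping.lookup f k))"

definition pos_nat_monoid :: "nat monoid"
  where "pos_nat_monoid = \<lparr>carrier = {0<..}, monoid.mult = (*), one = 1\<rparr>"

definition Gm_system :: "(rat, int \<Rightarrow>\<^sub>0 rat, nat) pointed_system"
  where "Gm_system =
    \<lparr>base = ring_of_type_algebra, coord = monoid_alg, point = laurent_eval 1,
     semigrp = pos_nat_monoid, act = laurent_power_subst\<rparr>"


section \<open>The Bost--Connes system over the rationals\<close>

quotient_type rat_mod_int = rat / "\<lambda>a b :: rat. a - b \<in> \<int>"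
proof (rule equivpI)
  show "reflp (\<lambda>a b :: rat. a - b \<in> \<int>)"
    by (simp add: reflp_def)
  show "symp (\<lambda>a b :: rat. a - b \<in> \<int>)"
    by (metis (no_types, lifting) Ints_minus minus_diff_eq sympI)
  show "transp (\<lambda>a b :: rat. a - b \<in> \<int>)"
    using Ints_add by (fastforce intro!: transpI)
qed

instantiation rat_mod_int :: ab_group_add
begin

lift_definition zero_rat_mod_int :: rat_mod_int is 0 .

lift_definition plus_rat_mod_int :: "rat_mod_int \<Rightarrow> rat_mod_int \<Rightarrow> rat_mod_int" is "(+)"
  by (metis (no_types, lifting) Ints_add add_diff_add)

lift_definition uminus_rat_mod_int :: "rat_mod_int \<Rightarrow> rat_mod_int" is uminus
  by (metis (no_types, lifting) Ints_minus minus_diff_minus)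

lift_definition minus_rat_mod_int :: "rat_mod_int \<Rightarrow> rat_mod_int \<Rightarrow> rat_mod_int" is "(-)"
  by (metis (no_types, lifting) Ints_diff diff_diff_eq diff_diff_eq2 add_diff_eq diff_add_eq add.commute)

instance
  by standard (transfer; simp)+

end

definition e_basis :: "rat_mod_int \<Rightarrow> (rat_mod_int \<Rightarrow>\<^sub>0 rat)"
  where "e_basis r = Poly_Mapping.single r 1"

definition bc_rho_basis :: "nat \<Rightarrow> rat_mod_int \<Rightarrow> (rat_mod_int \<Rightarrow>\<^sub>0 rat)"
  where "bc_rho_basis n r =
    (1 / of_nat n) \<odot>\<^bsub>monoid_alg\<^esub> (\<Sum>s | (\<Sum>i<n. s) = r. e_basis s)"

definition bc_rho :: "nat \<Rightarrow> (rat_mod_int \<Rightarrow>\<^sub>0 rat) \<Rightarrow> (rat_mod_int \<Rightarrow>\<^sub>0 rat)"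
  where "bc_rho n f =
    (\<Sum>r\<in>Poly_Mapping.keys f. Poly_Mapping.lookup f r \<odot>\<^bsub>monoid_alg\<^esub> bc_rho_basis n r)"

end

theory Submission
  imports Defs
begin

text \<open>
  Substituting the root of unity \<open>e\<^bsub>1/n\<^esub>\<close> for the coordinate of \<open>\<G>\<^sub>m\<close> gives a ring homomorphism
  \<open>at_root n : \<rat>[t, t\<^sup>-\<^sup>1] \<rightarrow> \<rat>[\<rat>/\<int>]\<close>, \<open>t\<^sup>k \<mapsto> e\<^bsub>k/n\<^esub>\<close>, whose kernel is the ideal of the fibre \<open>X\<^sub>n\<close>
  (\<open>fibre_ideal_eq\<close>). So \<open>A\<^sub>n\<close> is identified with the image of \<open>at_root n\<close>, which is
  \<open>\<rat>[(1/n)\<int>/\<int>]\<close>. The transition map \<open>t \<mapsto> t\<^sup>p\<close> from \<open>A\<^sub>n\<close> to \<open>A\<^sub>n\<^sub>p\<close> becomes the inclusion of these images,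
  since \<open>e\<^bsub>1/np\<^esub>\<close> has \<open>p\<close>-th power \<open>e\<^bsub>1/n\<^esub>\<close>. Every element of \<open>\<rat>/\<int>\<close> is torsion, so the images exhaust
  \<open>\<rat>[\<rat>/\<int>]\<close> and the inductive limit \<open>A\<close> is this group ring (\<open>lim_alg_parametrised\<close>): the element \<open>z\<close>
  corresponds to the class \<open>lim_elem z\<close>.

  Let \<open>e\<^sub>n\<close> (\<open>avg n\<close> below) be the average of the \<open>e\<^sub>s\<close> over \<open>ns = 0\<close>. It absorbs the
  \<open>n\<close>-torsion basis elements, hence is an idempotent, and in \<open>A\<^sub>n\<close> it is the characteristic function
  of the single point \<open>1\<close> of \<open>X\<^sub>n\<close>. As an idempotent has constant value on a connected set, \<open>{1}\<close> is the
  whole connected component, and so \<open>X\<^bsup>e\<^sub>n\<^esup>\<close> is the locus \<open>e\<^sub>n \<noteq> 0\<close> of \<open>Spec A\<close> (\<open>X_idem_eq\<close>).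

  The condition \<open>\<xi>\<^sub>n\<^sub>u \<circ> \<beta>\<^sub>n = \<xi>\<^sub>u\<close> says that the comorphism of \<open>\<beta>\<^sub>n\<close> sends \<open>e\<^bsub>k/nu\<^esub>\<close> to \<open>e\<^bsub>k/u\<^esub>\<close>, so it must
  be \<open>\<sigma>\<^sub>n : e\<^sub>r \<mapsto> e\<^bsub>nr\<^esub>\<close> (\<open>dilate n\<close> below). Translating the solutions of \<open>ns = 0\<close> by \<open>r\<close> gives
  \<open>\<rho>\<^sub>n(e\<^bsub>nr\<^esub>) = e\<^sub>n e\<^sub>r\<close> for the Bost--Connes endomorphism, that is \<open>\<rho>\<^sub>n \<circ> \<sigma>\<^sub>n = e\<^sub>n \<cdot> _\<close>; as \<open>\<rat>/\<int>\<close> is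
  divisible, \<open>\<sigma>\<^sub>n\<close> is onto and this determines \<open>\<rho>\<^sub>n\<close>, with \<open>\<sigma>\<^sub>n \<circ> \<rho>\<^sub>n = id\<close>. Thus \<open>\<sigma>\<^sub>n\<close> is an isomorphism of
  \<open>e\<^sub>n\<rat>[\<rat>/\<int>]\<close> with \<open>\<rat>[\<rat>/\<int>]\<close> with inverse \<open>\<rho>\<^sub>n\<close>, as \<open>\<beta>\<^sub>n\<close> requires (\<open>beta_lim_elem\<close>), and
  \<open>\<rho>\<^sub>n(f)\<close> is a function with the values prescribed by the construction (\<open>rho_lim_elem\<close>).

  There is only one such function because an element of \<open>\<rat>[\<rat>/\<int>]\<close> that vanishes at every prime ideal
  is zero. For this the kernels of the complex characters \<open>e\<^sub>r \<mapsto> exp(2\<pi>imr)\<close> are enough: by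
  orthogonality they recover the coefficients (\<open>char_eval_separates\<close>).
\<close>

section \<open>Additive maps out of a monoid algebra\<close>

text \<open>
  All maps out of monoid algebras below are sums, over the support, of terms that depend on a basis
  element and its coefficient. One definition of this form covers maps that are linear over the
  coefficients, evaluations in another ring, and the coefficient sum.
\<close>

definition lin_ext ::
    "('a \<Rightarrow> 'k::comm_monoid_add \<Rightarrow> 'c::comm_monoid_add) \<Rightarrow> ('a \<Rightarrow>\<^sub>0 'k) \<Rightarrow> 'c"
  where "lin_ext F f = (\<Sum>k\<in>Poly_Mapping.keys f. F k (Poly_Mapping.lookup f k))"

lemma poly_mapping_single_induct [case_names single add]:
  assumes single: "\<And>k c. P (Poly_Mapping.single k c)"
    and add: "\<And>f g. P f \<Longrightarrow> P g \<Longrightarrow> P (f + g)"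
  shows "P (f :: 'a \<Rightarrow>\<^sub>0 'k::comm_monoid_add)"
proof -
  have expand: "f = (\<Sum>k\<in>Poly_Mapping.keys f. Poly_Mapping.single k (Poly_Mapping.lookup f k))"
    by (rule poly_mapping_eqI) (auto simp: lookup_sum lookup_single when_def in_keys_iff)
  have "P (\<Sum>k\<in>S. Poly_Mapping.single k (Poly_Mapping.lookup f k))" if "finite S" for S
    using that
  proof induction
    case empty
    show ?case using single[of undefined 0] by simp
  qed (auto intro: single add)
  then show ?thesis by (subst expand) simp
qed

locale additive_coeffs =
  fixes F :: "'a \<Rightarrow> 'k::comm_monoid_add \<Rightarrow> 'c::comm_monoid_add"
  assumes zero: "F k 0 = 0"
    and add: "F k (a + b) = F k a + F k b"
begin

lemma lin_ext_single: "lin_ext F (Poly_Mapping.single k c) = F k c"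
  by (auto simp: lin_ext_def zero)

lemma lin_ext_zero: "lin_ext F 0 = 0"
  by (simp add: lin_ext_def)

text \<open>
  Sums over different supports can be compared after both are extended to a common finite set,
  because the additional terms are zero.
\<close>

lemma lin_ext_superset:
  "finite S \<Longrightarrow> Poly_Mapping.keys f \<subseteq> S \<Longrightarrow> lin_ext F f = (\<Sum>k\<in>S. F k (Poly_Mapping.lookup f k))"
  unfolding lin_ext_def
  by (intro sum.mono_neutral_left) (auto simp: in_keys_iff zero)

lemma lin_ext_add: "lin_ext F (f + g) = lin_ext F f + lin_ext F g"
proof -
  let ?S = "Poly_Mapping.keys f \<union> Poly_Mapping.keys g"
  have "lin_ext F h = (\<Sum>k\<in>?S. F k (Poly_Mapping.lookup h k))" if "h \<in> {f, g, f + g}" for h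
    using that keys_add[of f g] by (intro lin_ext_superset) auto
  then show ?thesis by (simp add: lookup_add add sum.distrib)
qed

end

lemma lin_ext_minus:
  assumes "additive_coeffs (F :: 'a \<Rightarrow> 'k::ab_group_add \<Rightarrow> 'c::ab_group_add)"
  shows "lin_ext F (f - g) = lin_ext F f - lin_ext F g"
  by (metis additive_coeffs.lin_ext_add[OF assms] add_diff_cancel_right' diff_add_cancel)

lemma lin_ext_mult:
  fixes F :: "'a::comm_monoid_add \<Rightarrow> 'k::comm_ring_1 \<Rightarrow> 'c::comm_ring_1"
  assumes F: "additive_coeffs F"
    and mult: "\<And>k l a b. F (k + l) (a * b) = F k a * F l b"
  shows "lin_ext F (f * g) = lin_ext F f * lin_ext F g"
proof (induction f rule: poly_mapping_single_induct)
  case (single k c)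
  show ?case
    by (induction g rule: poly_mapping_single_induct)
      (simp_all add: mult_single additive_coeffs.lin_ext_single[OF F] mult
        additive_coeffs.lin_ext_add[OF F] ring_distribs)
qed (simp add: additive_coeffs.lin_ext_add[OF F] ring_distribs)

definition pushforward :: "('a \<Rightarrow> 'b) \<Rightarrow> ('a \<Rightarrow>\<^sub>0 'k) \<Rightarrow> ('b \<Rightarrow>\<^sub>0 'k::comm_monoid_add)"
  where "pushforward \<phi> = lin_ext (\<lambda>k c. Poly_Mapping.single (\<phi> k) c)"

lemma additive_pushforward:
  "additive_coeffs (\<lambda>k c. Poly_Mapping.single (\<phi> k) (c :: 'k::comm_monoid_add))"
  by standard (simp_all add: single_add)

lemmas pushforward_single [simp] =
    additive_coeffs.lin_ext_single[OF additive_pushforward, folded pushforward_def]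
  and pushforward_zero [simp] =
    additive_coeffs.lin_ext_zero[OF additive_pushforward, folded pushforward_def]
  and pushforward_add [simp] =
    additive_coeffs.lin_ext_add[OF additive_pushforward, folded pushforward_def]
  and pushforward_diff [simp] =
    lin_ext_minus[OF additive_pushforward, folded pushforward_def]

lemma pushforward_pushforward:
  "pushforward \<phi> (pushforward \<psi> f) = pushforward (\<phi> \<circ> \<psi>) f"
  by (induction f rule: poly_mapping_single_induct) simp_all

lemma pushforward_mult:
  fixes \<phi> :: "'a::comm_monoid_add \<Rightarrow> 'b::comm_monoid_add"
  assumes "\<And>k l. \<phi> (k + l) = \<phi> k + \<phi> l"
  shows "pushforward \<phi> (f * g) = pushforward \<phi> f * (pushforward \<phi> g :: _ \<Rightarrow>\<^sub>0 'k::comm_ring_1)"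
  unfolding pushforward_def
  by (rule lin_ext_mult[OF additive_pushforward, of \<phi>]) (simp add: assms mult_single)

section \<open>Torsion in \<open>\<rat>/\<int>\<close>\<close>

text \<open>
  \<open>ratio n k\<close> is the class of \<open>k/n\<close>, the exponent of the \<open>k\<close>-th power of the chosen primitive
  \<open>n\<close>-th root of unity.
\<close>

definition ratio :: "nat \<Rightarrow> int \<Rightarrow> rat_mod_int"
  where "ratio n k = abs_rat_mod_int (of_int k / of_nat n)"

lemma ratio_add: "ratio n (k + l) = ratio n k + ratio n l"
  by (simp add: ratio_def plus_rat_mod_int.abs_eq add_divide_distrib)

lemma ratio_zero [simp]: "ratio n 0 = 0"
  by (simp add: ratio_def zero_rat_mod_int_def)

lemma ratio_scale:
  assumes "p > 0"
  shows "ratio (n * p) (int p * k) = ratio n k"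
  using assms by (simp add: ratio_def field_simps)

lemma ratio_eq_iff:
  assumes "n > 0"
  shows "ratio n k = ratio n l \<longleftrightarrow> int n dvd k - l"
proof -
  have "ratio n k = ratio n l \<longleftrightarrow> (of_int (k - l) / of_nat n :: rat) \<in> \<int>"
    by (simp add: ratio_def rat_mod_int.abs_eq_iff diff_divide_distrib)
  also have "\<dots> \<longleftrightarrow> (\<exists>q. k - l = int n * q)"
  proof -
    have "(of_int (k - l) / of_nat n :: rat) = of_int q \<longleftrightarrow> k - l = int n * q" for q
    proof -
      have "(of_int (k - l) / of_nat n :: rat) = of_int q \<longleftrightarrow>
          (of_int (k - l) :: rat) = of_int (int n * q)"
        using assms by (auto simp: field_simps)
      then show ?thesis unfolding of_int_eq_iff .
    qed
    then show ?thesis unfolding Ints_def by blast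
  qed
  finally show ?thesis by (auto simp: dvd_def)
qed

lemma ratio_exhaust:
  obtains n k where "n > 0" "r = ratio n k"
proof -
  obtain x where x: "r = abs_rat_mod_int x"
    by (metis Quotient_abs_rep Quotient_rat_mod_int)
  obtain a b where ab: "quotient_of x = (a, b)" by force
  then have "b > 0" "x = of_int a / of_int b"
    using quotient_of_denom_pos quotient_of_div by blast+
  with x that[of "nat b" a] show ?thesis by (simp add: ratio_def)
qed

abbreviation multiple :: "nat \<Rightarrow> rat_mod_int \<Rightarrow> rat_mod_int"
  where "multiple n r \<equiv> (\<Sum>i<n. r)"

lemma multiple_ratio: "multiple n (ratio m k) = ratio m (int n * k)"
  by (induction n) (simp_all add: ratio_add[symmetric] algebra_simps)

lemma multiple_ratio_cancel:
  assumes "n > 0"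
  shows "multiple n (ratio (n * u) k) = ratio u k"
  using ratio_scale[OF assms, of u k] by (simp add: multiple_ratio mult.commute)

lemma multiple_add: "multiple n (r + s) = multiple n r + multiple n s"
  by (rule sum.distrib)

text \<open>
  If \<open>s = k/m\<close> and \<open>ns = 0\<close>, then \<open>nk = mq\<close> for some \<open>q\<close>, so \<open>s = q/n\<close>, and \<open>q\<close> only matters
  modulo \<open>n\<close>.
\<close>

lemma torsion_eq:
  assumes "n > 0"
  shows "{s. multiple n s = 0} = ratio n ` {0..<int n}"
proof (intro equalityI subsetI)
  fix s assume "s \<in> {s. multiple n s = 0}"
  then have s: "multiple n s = 0" by simp
  obtain m k where mk: "m > 0" "s = ratio m k" by (rule ratio_exhaust)
  with s have "int m dvd int n * k"
    using ratio_eq_iff[of m "int n * k" 0] by (simp add: multiple_ratio)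
  then obtain q where q: "int n * k = int m * q" by (auto simp: dvd_def)
  have "s = ratio (m * n) (int n * k)" using mk ratio_scale[OF assms, of m k] by simp
  also have "\<dots> = ratio n q" unfolding q using ratio_scale[OF mk(1), of n q] by (simp add: mult.commute)
  also have "\<dots> = ratio n (q mod int n)"
    using ratio_eq_iff[OF assms] by (simp add: minus_mod_eq_mult_div)
  finally show "s \<in> ratio n ` {0..<int n}" using assms by auto
next
  fix s assume "s \<in> ratio n ` {0..<int n}"
  then obtain k where "s = ratio n k" by auto
  then show "s \<in> {s. multiple n s = 0}"
    using ratio_eq_iff[OF assms, of "int n * k" 0] by (simp add: multiple_ratio)
qed

lemma inj_on_ratio:
  assumes "n > 0"
  shows "inj_on (ratio n) {0..<int n}"
proof (rule inj_onI)
  fix k l assume kl: "k \<in> {0..<int n}" "l \<in> {0..<int n}" "ratio n k = ratio n l"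
  then have "k mod int n = l mod int n"
    using ratio_eq_iff[OF assms] mod_eq_dvd_iff by blast
  with kl show "k = l" by simp
qed

section \<open>Substituting a root of unity for the coordinate\<close>

abbreviation at_root :: "nat \<Rightarrow> (int \<Rightarrow>\<^sub>0 rat) \<Rightarrow> (rat_mod_int \<Rightarrow>\<^sub>0 rat)"
  where "at_root n \<equiv> pushforward (ratio n)"

lemma at_root_mult: "at_root n (f * g) = at_root n f * at_root n g"
  by (rule pushforward_mult) (rule ratio_add)

lemma at_root_one: "at_root n 1 = 1"
  by (metis pushforward_single ratio_zero single_one)

lemma laurent_power_subst_eq: "laurent_power_subst n = pushforward (\<lambda>k. int n * k)"
  by (rule ext) (simp add: laurent_power_subst_def pushforward_def lin_ext_def)

text \<open>
  The transition maps of the fibres are compatible with the embeddings of the fibre algebras in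
  \<open>\<rat>[\<rat>/\<int>]\<close>.
\<close>

lemma at_root_power_subst:
  "p > 0 \<Longrightarrow> at_root (n * p) (laurent_power_subst p f) = at_root n f"
  by (simp add: laurent_power_subst_eq pushforward_pushforward comp_def ratio_scale)

lemma range_at_root_mono:
  "p > 0 \<Longrightarrow> range (at_root n) \<subseteq> range (at_root (n * p))"
  using at_root_power_subst by (metis image_subsetI rangeI)

text \<open>
  A finite sum of basis elements has a common denominator, which can be taken to be a multiple of
  any given \<open>m\<close>.
\<close>

lemma at_root_cover:
  assumes "m > 0"
  obtains n where "n > 0" "z \<in> range (at_root (m * n))"
proof -
  have "\<exists>n>0. z \<in> range (at_root n)"
  proof (induction z rule: poly_mapping_single_induct)
    case (single r c)
    obtain n k where "n > 0" "r = ratio n k" by (rule ratio_exhaust)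
    then have "Poly_Mapping.single r c = at_root n (Poly_Mapping.single k c)" by simp
    with \<open>n > 0\<close> show ?case by blast
  next
    case (add z w)
    then obtain n p where "n > 0" "p > 0" "z \<in> range (at_root n)" "w \<in> range (at_root p)" by blast
    then have "z \<in> range (at_root (n * p))" "w \<in> range (at_root (n * p))"
      using range_at_root_mono[of p n] range_at_root_mono[of n p] by (auto simp: mult.commute)
    then obtain f g where "z = at_root (n * p) f" "w = at_root (n * p) g" by blast
    then have "z + w = at_root (n * p) (f + g)" by simp
    with \<open>n > 0\<close> \<open>p > 0\<close> show ?case by (metis nat_0_less_mult_iff rangeI)
  qed
  then obtain n where "n > 0" "z \<in> range (at_root n)" by blast
  with range_at_root_mono[OF assms, of n] show ?thesis by (intro that[of n]) (auto simp: mult.commute)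
qed

lemma at_root_common:
  obtains n where "n > 0" "z \<in> range (at_root n)" "w \<in> range (at_root n)"
proof -
  obtain m where m: "m > 0" "z \<in> range (at_root (1 * m))" by (rule at_root_cover[of 1]) auto
  obtain n where "n > 0" "w \<in> range (at_root (m * n))" by (rule at_root_cover[OF m(1)])
  with m range_at_root_mono[of n m] show ?thesis by (intro that[of "m * n"]) auto
qed

section \<open>Transport of ring structure and Zariski topology\<close>

text \<open>
  Both the fibre algebras and their limit are rings of sets whose elements are indexed by elements
  of a subring of \<open>\<rat>[\<rat>/\<int>]\<close>. The locale transports computations in such a record \<open>S\<close> to the ring \<open>'c\<close>,
  where the usual arithmetic is available, along an isomorphism \<open>\<theta>\<close> from the subring \<open>V\<close> to \<open>S\<close>.
\<close>

locale parametrised_ring =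
  fixes S :: "('a, 'm) ring_scheme" (structure)
    and V :: "'c::comm_ring_1 set" and \<theta> :: "'c \<Rightarrow> 'a"
  assumes one_V: "1 \<in> V"
    and diff_V: "a \<in> V \<Longrightarrow> b \<in> V \<Longrightarrow> a - b \<in> V"
    and mult_V: "a \<in> V \<Longrightarrow> b \<in> V \<Longrightarrow> a * b \<in> V"
    and carrier_eq: "carrier S = \<theta> ` V"
    and inj: "inj_on \<theta> V"
    and zero_eq: "\<zero> = \<theta> 0"
    and one_eq: "\<one> = \<theta> 1"
    and add_eq: "a \<in> V \<Longrightarrow> b \<in> V \<Longrightarrow> \<theta> a \<oplus> \<theta> b = \<theta> (a + b)"
    and mult_eq: "a \<in> V \<Longrightarrow> b \<in> V \<Longrightarrow> \<theta> a \<otimes> \<theta> b = \<theta> (a * b)"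
begin

lemma zero_V: "0 \<in> V"
  using diff_V[OF one_V one_V] by simp

lemma uminus_V: "a \<in> V \<Longrightarrow> - a \<in> V"
  using diff_V[OF zero_V] by simp

lemma add_V: "a \<in> V \<Longrightarrow> b \<in> V \<Longrightarrow> a + b \<in> V"
  using diff_V[OF _ uminus_V] by simp

lemma cring: "cring S"
proof (rule cringI)
  show "abelian_group S"
  proof (rule abelian_groupI)
    fix x assume "x \<in> carrier S"
    then obtain a where "a \<in> V" "x = \<theta> a" by (auto simp: carrier_eq)
    then show "\<exists>y\<in>carrier S. y \<oplus> x = \<zero>"
      by (intro bexI[of _ "\<theta> (- a)"]) (simp_all add: carrier_eq add_eq zero_eq uminus_V)
  qed (auto simp: carrier_eq zero_eq add_eq add_V zero_V ac_simps)
  show "comm_monoid S"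
    by (rule comm_monoidI) (auto simp: carrier_eq one_eq mult_eq one_V mult_V ac_simps)
qed (auto simp: carrier_eq mult_eq add_eq mult_V add_V ring_distribs)

lemma a_inv_eq:
  assumes "a \<in> V" shows "\<ominus> \<theta> a = \<theta> (- a)"
proof -
  interpret cring S by (rule cring)
  have "\<theta> (- a) \<oplus> \<theta> a = \<zero>" using assms uminus_V by (simp add: add_eq zero_eq)
  then show ?thesis using assms uminus_V by (intro minus_equality) (auto simp: carrier_eq)
qed

lemma fun_value_eq_iff:
  assumes "ideal x S" "a \<in> V" "b \<in> V"
  shows "fun_value S (\<theta> a) x = fun_value S (\<theta> b) x \<longleftrightarrow> \<theta> (a - b) \<in> x"
proof -
  interpret cring S by (rule cring)
  have "\<theta> a \<ominus> \<theta> b = \<theta> (a - b)"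
    using assms uminus_V by (simp add: a_minus_def a_inv_eq add_eq)
  then show ?thesis
    using quotient_eq_iff_same_a_r_cos[OF assms(1), of "\<theta> a" "\<theta> b"] assms
    by (auto simp: fun_value_def carrier_eq)
qed

text \<open>
  The quotient embeds in a domain.
\<close>

lemma primeideal_kernel:
  fixes \<chi> :: "'c \<Rightarrow> 'd::idom"
  assumes add: "\<And>a b. \<chi> (a + b) = \<chi> a + \<chi> b"
    and mult: "\<And>a b. \<chi> (a * b) = \<chi> a * \<chi> b"
    and one: "\<chi> 1 = 1"
  shows "primeideal (\<theta> ` {a \<in> V. \<chi> a = 0}) S"
proof -
  interpret cring S by (rule cring)
  have zero: "\<chi> 0 = 0" using add[of 0 0] by (metis add_0 add_cancel_right_right)
  have uminus: "\<chi> (- a) = - \<chi> a" for a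
    using add[of "- a" a] zero by (simp add: eq_neg_iff_add_eq_0)
  have mem: "\<theta> a \<in> \<theta> ` {a \<in> V. \<chi> a = 0} \<longleftrightarrow> \<chi> a = 0" if "a \<in> V" for a
    using that inj by (auto dest: inj_onD)
  show ?thesis
  proof (rule primeidealI2[OF _ cring])
    show "additive_subgroup (\<theta> ` {a \<in> V. \<chi> a = 0}) S"
    proof (intro additive_subgroup.intro subgroup.intro, goal_cases)
      case (2 x y)
      then show ?case by (auto simp: add_eq add add_V)
    next
      case (4 x)
      then show ?case
        by (auto simp: a_inv_def[symmetric] a_inv_eq uminus uminus_V)
    qed (auto simp: carrier_eq zero_eq zero zero_V)
    show "carrier S \<noteq> \<theta> ` {a \<in> V. \<chi> a = 0}"
      using mem[OF one_V] one one_V by (auto simp: carrier_eq)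
  next
    fix a b assume "a \<in> carrier S" "b \<in> carrier S" "a \<otimes> b \<in> \<theta> ` {a \<in> V. \<chi> a = 0}"
    moreover from this obtain u v where "u \<in> V" "v \<in> V" "a = \<theta> u" "b = \<theta> v"
      by (auto simp: carrier_eq)
    ultimately show "a \<in> \<theta> ` {a \<in> V. \<chi> a = 0} \<or> b \<in> \<theta> ` {a \<in> V. \<chi> a = 0}"
      using mem[of "u * v"] by (simp add: mem mult_eq mult_V mult)
  qed (auto simp: carrier_eq mult_eq mult mult_V)
qed

lemma prime_mult_iff:
  assumes "primeideal x S" "a \<in> V" "b \<in> V"
  shows "\<theta> (a * b) \<in> x \<longleftrightarrow> \<theta> a \<in> x \<or> \<theta> b \<in> x"
proof -
  interpret primeideal x S by fact
  have "\<theta> a \<in> carrier S" "\<theta> b \<in> carrier S" using assms by (simp_all add: carrier_eq)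
  then show ?thesis
    using I_prime[of "\<theta> a" "\<theta> b"] I_l_closed[of "\<theta> b" "\<theta> a"] I_r_closed[of "\<theta> a" "\<theta> b"] assms
    by (auto simp: mult_eq)
qed

lemma prime_zero: "primeideal x S \<Longrightarrow> \<theta> 0 \<in> x"
  using additive_subgroup.zero_closed[OF ideal.axioms(1)[OF primeideal.axioms(1)]] zero_eq by metis

lemma prime_one:
  assumes "primeideal x S"
  shows "\<theta> 1 \<notin> x"
  using ideal.one_imp_carrier[OF primeideal.axioms(1)[OF assms]]
    primeideal.I_notcarr[OF assms] one_eq by auto

text \<open>
  Since \<open>e(1 - e) = 0\<close> one of the two lies in the prime, and since \<open>e + (1 - e) = 1\<close> not both do.
\<close>

lemma prime_complement_iff:
  assumes "primeideal x S" "e \<in> V" "e * e = e"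
  shows "\<theta> (1 - e) \<in> x \<longleftrightarrow> \<theta> e \<notin> x"
proof
  have V: "1 - e \<in> V" using diff_V one_V assms by simp
  show "\<theta> e \<notin> x" if "\<theta> (1 - e) \<in> x"
  proof
    assume "\<theta> e \<in> x"
    from additive_subgroup.a_closed[OF ideal.axioms(1)[OF primeideal.axioms(1)[OF assms(1)]] this that]
    have "\<theta> 1 \<in> x" using V assms by (simp add: add_eq)
    with prime_one assms show False by blast
  qed
  have "e * (1 - e) = 0" using assms by (simp add: algebra_simps)
  then have "\<theta> (e * (1 - e)) \<in> x" using prime_zero assms by simp
  then show "\<theta> (1 - e) \<in> x" if "\<theta> e \<notin> x"
    using that prime_mult_iff[OF assms(1,2) V] by simp
qed

lemma topspace_zariski: "topspace (zariski S) = Spec S"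
proof -
  have "x \<in> (\<Union>f\<in>carrier S. {p \<in> Spec S. f \<notin> p})" if "x \<in> Spec S" for x
    using that prime_one[of x] one_V by (auto simp: Spec_def carrier_eq)
  then show ?thesis by (auto simp: zariski_def)
qed

text \<open>
  The loci \<open>e \<noteq> 0\<close> and \<open>1 - e \<noteq> 0\<close> are disjoint open sets that cover the spectrum.
\<close>

lemma idempotent_constant_on_component:
  assumes "connected_component_of (zariski S) x y" "e \<in> V" "e * e = e" "\<theta> e \<notin> x"
  shows "\<theta> e \<notin> y"
proof
  assume "\<theta> e \<in> y"
  obtain C where C: "connectedin (zariski S) C" "x \<in> C" "y \<in> C"
    using assms(1) by (auto simp: connected_component_of_def)
  then have CS: "C \<subseteq> Spec S"
    using connectedin_subset_topspace topspace_zariski by blast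
  have split: "\<theta> (1 - e) \<in> p \<longleftrightarrow> \<theta> e \<notin> p" if "p \<in> Spec S" for p
    using prime_complement_iff[OF _ assms(2,3)] that by (simp add: Spec_def)
  let ?D = "\<lambda>f. {p \<in> Spec S. \<theta> f \<notin> p}"
  have D: "openin (zariski S) (?D f)" if "f \<in> V" for f
    unfolding zariski_def by (rule topology_generated_by_Basis) (use that in \<open>auto simp: carrier_eq\<close>)
  have "1 - e \<in> V" using diff_V one_V assms by simp
  have "C \<subseteq> ?D e \<union> ?D (1 - e)" "?D e \<inter> ?D (1 - e) \<inter> C = {}" "?D e \<inter> C \<noteq> {}" "?D (1 - e) \<inter> C \<noteq> {}"
    using CS C split assms(4) \<open>\<theta> e \<in> y\<close> by auto
  with connectedinD[OF C(1) D[OF assms(2)] D[OF \<open>1 - e \<in> V\<close>]] show False by blast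
qed

end

section \<open>The fibres and their limit\<close>

lemma monoid_alg_simps [simp]:
  fixes f g :: "'g::comm_monoid_add \<Rightarrow>\<^sub>0 'k::comm_ring_1"
  shows "carrier (monoid_alg :: ('k, 'g \<Rightarrow>\<^sub>0 'k) module) = UNIV"
    and "f \<otimes>\<^bsub>monoid_alg\<^esub> g = f * g"
    and "f \<oplus>\<^bsub>monoid_alg\<^esub> g = f + g"
    and "\<one>\<^bsub>monoid_alg\<^esub> = (1 :: 'g \<Rightarrow>\<^sub>0 'k)"
    and "\<zero>\<^bsub>monoid_alg\<^esub> = (0 :: 'g \<Rightarrow>\<^sub>0 'k)"
    and "k \<odot>\<^bsub>monoid_alg\<^esub> f = Poly_Mapping.single 0 k * f"
  by (simp_all add: monoid_alg_def ring.defs ring_of_type_algebra_def)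

lemma cring_monoid_alg: "cring (monoid_alg :: ('k::comm_ring_1, 'g::comm_monoid_add \<Rightarrow>\<^sub>0 'k) module)"
  by (rule parametrised_ring.cring[of _ UNIV id]) (standard; simp)

lemma Gm_system_simps [simp]:
  "base Gm_system = ring_of_type_algebra" "coord Gm_system = monoid_alg"
  "point Gm_system = laurent_eval 1" "act Gm_system = laurent_power_subst"
  "carrier (semigrp Gm_system) = {0<..}" "\<one>\<^bsub>semigrp Gm_system\<^esub> = 1"
  "s \<otimes>\<^bsub>semigrp Gm_system\<^esub> r = s * r"
  by (simp_all add: Gm_system_def pos_nat_monoid_def)

text \<open>
  This is evaluation at the point \<open>1\<close> of \<open>\<G>\<^sub>m\<close>, and it also makes sense on \<open>\<rat>[\<rat>/\<int>]\<close>.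
\<close>

definition augmentation :: "('a \<Rightarrow>\<^sub>0 'k) \<Rightarrow> 'k::comm_monoid_add"
  where "augmentation = lin_ext (\<lambda>_ c. c)"

lemma additive_augmentation: "additive_coeffs (\<lambda>_ c. c)"
  by standard simp_all

lemmas augmentation_single [simp] =
    additive_coeffs.lin_ext_single[OF additive_augmentation, folded augmentation_def]
  and augmentation_zero [simp] =
    additive_coeffs.lin_ext_zero[OF additive_augmentation, folded augmentation_def]
  and augmentation_add [simp] =
    additive_coeffs.lin_ext_add[OF additive_augmentation, folded augmentation_def]
  and augmentation_diff [simp] =
    lin_ext_minus[OF additive_augmentation, folded augmentation_def]

lemma augmentation_mult:
  "augmentation (f * g :: 'a::comm_monoid_add \<Rightarrow>\<^sub>0 'k::comm_ring_1) = augmentation f * augmentation g"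
  unfolding augmentation_def by (rule lin_ext_mult[OF additive_augmentation]) simp

lemma augmentation_one [simp]: "augmentation (1 :: 'a::comm_monoid_add \<Rightarrow>\<^sub>0 'k::comm_ring_1) = 1"
  by (metis augmentation_single single_one)

lemma augmentation_pushforward: "augmentation (pushforward \<phi> f) = augmentation f"
  by (induction f rule: poly_mapping_single_induct) simp_all

lemma laurent_eval_one: "laurent_eval 1 = augmentation"
  by (rule ext) (simp add: laurent_eval_def augmentation_def lin_ext_def)

lemma point_ideal_eq: "point_ideal Gm_system = {f. augmentation f = 0}"
  by (simp add: point_ideal_def a_kernel_def' laurent_eval_one ring_of_type_algebra_def)

text \<open>
  The generators \<open>f(t\<^sup>n)\<close> with \<open>f(1) = 0\<close> vanish at any \<open>n\<close>-th root of unity. Conversely, choose an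
  exponent for each element of \<open>\<rat>/\<int>\<close>. Replacing each \<open>t\<^sup>k\<close> by \<open>t\<^sup>l\<close>, where \<open>l\<close> is the exponent chosen for
  \<open>k/n\<close>, changes \<open>f\<close> by an element of the ideal, because \<open>t\<^sup>k - t\<^sup>l\<close> is a multiple of \<open>t\<^bsup>nq\<^esup> - 1\<close> with
  \<open>k = l + nq\<close>. The result only depends on \<open>at_root n f\<close>, so it is zero if \<open>f\<close> is in the kernel.
\<close>

lemma fibre_ideal_eq:
  assumes "n > 0"
  shows "fibre_ideal Gm_system n = {f. at_root n f = 0}"
proof
  interpret B: cring "monoid_alg :: (rat, int \<Rightarrow>\<^sub>0 rat) module" by (rule cring_monoid_alg)
  interpret R: cring "monoid_alg :: (rat, rat_mod_int \<Rightarrow>\<^sub>0 rat) module" by (rule cring_monoid_alg)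
  let ?I = "fibre_ideal Gm_system n"
  have I_def: "?I = Idl\<^bsub>monoid_alg\<^esub> (laurent_power_subst n ` {f. augmentation f = 0})"
    by (simp add: fibre_ideal_def point_ideal_eq)
  have hom: "at_root n \<in> ring_hom monoid_alg monoid_alg"
    by (intro ring_hom_memI) (simp_all only: monoid_alg_simps at_root_mult at_root_one pushforward_add UNIV_I)
  have "ideal (a_kernel monoid_alg monoid_alg (at_root n)) monoid_alg"
    by (rule ring_hom_ring.kernel_is_ideal[OF ring_hom_ringI2[OF B.ring_axioms R.ring_axioms hom]])
  then have ker: "ideal {f. at_root n f = 0} monoid_alg"
    by (simp only: a_kernel_def' monoid_alg_simps UNIV_I simp_thms)
  have "ratio n (int n * k) = 0" for k
    using ratio_eq_iff[OF assms, of _ 0] by simp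
  then have at_root_subst: "at_root n (laurent_power_subst n f) = Poly_Mapping.single 0 (augmentation f)" for f
    by (induction f rule: poly_mapping_single_induct) (simp_all add: laurent_power_subst_eq single_add)
  show "?I \<subseteq> {f. at_root n f = 0}"
    unfolding I_def by (rule B.genideal_minimal[OF ker]) (auto simp: at_root_subst)
  interpret I: ideal ?I "monoid_alg :: (rat, int \<Rightarrow>\<^sub>0 rat) module"
    unfolding I_def by (rule B.genideal_ideal) simp
  (* A section of \<open>ratio n\<close> on its image, which provides the chosen exponents. *)
  define s where "s = (\<lambda>r. SOME k. ratio n k = r)"
  have s: "ratio n (s (ratio n k)) = ratio n k" for k
    unfolding s_def by (rule someI_ex) blast
  have reduce: "f - pushforward s (at_root n f) \<in> ?I" for f
  proof (induction f rule: poly_mapping_single_induct)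
    case (single k c)
    define l where "l = s (ratio n k)"
    have "ratio n k = ratio n l" by (simp add: l_def s)
    then obtain q where q: "k = l + int n * q"
      unfolding ratio_eq_iff[OF assms] by (auto simp: dvd_def algebra_simps)
    have "laurent_power_subst n (Poly_Mapping.single q 1 - Poly_Mapping.single 0 1) \<in> ?I"
      unfolding I_def by (rule subsetD[OF B.genideal_self]) auto
    then have "Poly_Mapping.single (int n * q) 1 - 1 \<in> ?I"
      unfolding laurent_power_subst_eq pushforward_diff pushforward_single by simp
    from I.I_l_closed[OF this, of "Poly_Mapping.single l c"]
    have "Poly_Mapping.single k c - Poly_Mapping.single l c \<in> ?I"
      by (simp add: q mult_single right_diff_distrib)
    then show ?case by (simp add: l_def)
  next
    case (add f g)
    from I.a_closed[OF add] show ?case by (simp add: algebra_simps)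
  qed
  show "{f. at_root n f = 0} \<subseteq> ?I"
  proof
    fix f assume "f \<in> {f. at_root n f = 0}"
    with reduce[of f] show "f \<in> ?I" by simp
  qed
qed

text \<open>
  The element of \<open>A\<^sub>n\<close> that corresponds to \<open>z\<close>, provided that \<open>z\<close> is in the image of \<open>at_root n\<close>;
  otherwise the set is empty and not an element of \<open>A\<^sub>n\<close>.
\<close>

abbreviation fibre_elem :: "nat \<Rightarrow> (rat_mod_int \<Rightarrow>\<^sub>0 rat) \<Rightarrow> (int \<Rightarrow>\<^sub>0 rat) set"
  where "fibre_elem n z \<equiv> at_root n -` {z}"

lemma inj_on_fibre_elem: "inj_on (fibre_elem n) (range (at_root n))"
  by (rule inj_onI) blast

lemma fibre_coset:
  assumes "n > 0"
  shows "fibre_ideal Gm_system n +>\<^bsub>monoid_alg\<^esub> f = fibre_elem n (at_root n f)"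
proof
  show "fibre_elem n (at_root n f) \<subseteq> fibre_ideal Gm_system n +>\<^bsub>monoid_alg\<^esub> f"
  proof
    fix g assume "g \<in> fibre_elem n (at_root n f)"
    then have "at_root n (g - f) = 0" by simp
    then show "g \<in> fibre_ideal Gm_system n +>\<^bsub>monoid_alg\<^esub> f"
      by (auto simp: a_r_coset_def' fibre_ideal_eq[OF assms] intro!: exI[of _ "g - f"])
  qed
qed (auto simp: a_r_coset_def' fibre_ideal_eq[OF assms])

lemma fibre_alg_carrier:
  "n > 0 \<Longrightarrow> carrier (fibre_alg Gm_system n) = fibre_elem n ` range (at_root n)"
  by (auto simp: fibre_alg_def quot_alg_def ring.defs FactRing_def A_RCOSETS_def' fibre_coset)

lemma fibre_alg_smult:
  assumes "n > 0" "z \<in> range (at_root n)"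
  shows "k \<odot>\<^bsub>fibre_alg Gm_system n\<^esub> fibre_elem n z = fibre_elem n (Poly_Mapping.single 0 k * z)"
proof -
  have "at_root n (Poly_Mapping.single 0 k) = Poly_Mapping.single 0 k" by simp
  with assms show ?thesis
    by (auto simp: fibre_alg_def quot_alg_def ring.defs fibre_coset at_root_mult)
qed

lemma fibre_alg_parametrised:
  assumes "n > 0"
  shows "parametrised_ring (fibre_alg Gm_system n) (range (at_root n)) (fibre_elem n)"
proof
  show "1 \<in> range (at_root n)" by (metis at_root_one rangeI)
  show "a - b \<in> range (at_root n)" "a * b \<in> range (at_root n)"
    if "a \<in> range (at_root n)" "b \<in> range (at_root n)" for a b
  proof -
    from that obtain f g where fg: "a = at_root n f" "b = at_root n g" by blast
    show "a - b \<in> range (at_root n)" unfolding fg pushforward_diff[symmetric] by (rule rangeI)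
    show "a * b \<in> range (at_root n)" unfolding fg at_root_mult[symmetric] by (rule rangeI)
  qed
  show "carrier (fibre_alg Gm_system n) = fibre_elem n ` range (at_root n)"
    by (rule fibre_alg_carrier[OF assms])
  show "inj_on (fibre_elem n) (range (at_root n))" by (rule inj_on_fibre_elem)
  show "\<zero>\<^bsub>fibre_alg Gm_system n\<^esub> = fibre_elem n 0"
    by (auto simp: fibre_alg_def quot_alg_def ring.defs FactRing_def fibre_ideal_eq[OF assms])
  show "\<one>\<^bsub>fibre_alg Gm_system n\<^esub> = fibre_elem n 1"
    by (simp add: fibre_alg_def quot_alg_def ring.defs FactRing_def fibre_coset[OF assms] at_root_one)
  fix a b assume ab: "a \<in> range (at_root n)" "b \<in> range (at_root n)"
  then obtain f g where fg: "a = at_root n f" "b = at_root n g" by blast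
  show "fibre_elem n a \<otimes>\<^bsub>fibre_alg Gm_system n\<^esub> fibre_elem n b = fibre_elem n (a * b)"
    using fg by (auto simp: fibre_alg_def quot_alg_def ring.defs FactRing_def rcoset_mult_def
        fibre_coset[OF assms] at_root_mult)
  have "c \<in> fibre_elem n (a + b) \<Longrightarrow> c - g \<in> fibre_elem n a" for c by (simp add: fg)
  then have "\<exists>x\<in>fibre_elem n a. \<exists>y\<in>fibre_elem n b. c = x + y" if "c \<in> fibre_elem n (a + b)" for c
    using that fg by (intro bexI[of _ "c - g"] bexI[of _ g]) auto
  then show "fibre_elem n a \<oplus>\<^bsub>fibre_alg Gm_system n\<^esub> fibre_elem n b = fibre_elem n (a + b)"
    by (auto simp: fibre_alg_def quot_alg_def ring.defs FactRing_def set_add_def')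
qed

text \<open>
  The transition maps become inclusions of subrings of \<open>\<rat>[\<rat>/\<int>]\<close>.
\<close>

lemma trans_map_fibre_elem:
  assumes "n > 0" "p > 0" "z \<in> range (at_root n)"
  shows "trans_map Gm_system n p (fibre_elem n z) = fibre_elem (n * p) z"
  using assms by (auto simp: trans_map_def fibre_coset at_root_power_subst)

text \<open>
  The set of all representatives, at all levels, of the element of the limit that corresponds to \<open>z\<close>.
\<close>

definition lim_elem :: "(rat_mod_int \<Rightarrow>\<^sub>0 rat) \<Rightarrow> (nat \<times> (int \<Rightarrow>\<^sub>0 rat) set) set"
  where "lim_elem z = {(n, fibre_elem n z) | n. n > 0 \<and> z \<in> range (at_root n)}"

text \<open>
  Two elements become equal at a common level iff they correspond to the same \<open>z\<close>, because every
  level is embedded in \<open>\<rat>[\<rat>/\<int>]\<close>. The levels \<open>n\<close> and \<open>t\<close> meet at \<open>nt\<close>.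
\<close>

lemma lim_class_fibre_elem:
  assumes "n > 0" "z \<in> range (at_root n)"
  shows "lim_class Gm_system n (fibre_elem n z) = lim_elem z"
proof (intro equalityI subrelI)
  fix t b assume "(t, b) \<in> lim_class Gm_system n (fibre_elem n z)"
  then obtain p q where pq: "t > 0" "p > 0" "q > 0" "b \<in> carrier (fibre_alg Gm_system t)"
      "n * p = t * q" "trans_map Gm_system n p (fibre_elem n z) = trans_map Gm_system t q b"
    by (auto simp: lim_class_def)
  from pq(1,4) obtain w where w: "w \<in> range (at_root t)" "b = fibre_elem t w"
    unfolding fibre_alg_carrier[OF pq(1)] by blast
  have eq: "fibre_elem (n * p) z = fibre_elem (n * p) w"
    using pq w by (simp only: trans_map_fibre_elem assms)
  have "z \<in> range (at_root (n * p))" "w \<in> range (at_root (n * p))"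
    using range_at_root_mono[of p n] range_at_root_mono[of q t] pq w assms by auto
  with eq inj_on_fibre_elem have "z = w" by (metis inj_onD)
  with pq(1) w show "(t, b) \<in> lim_elem z" unfolding lim_elem_def by blast
next
  fix t b assume "(t, b) \<in> lim_elem z"
  then have *: "t > 0" "z \<in> range (at_root t)" "b = fibre_elem t z" by (auto simp: lim_elem_def)
  then have "\<exists>p>0. \<exists>q>0. n * p = t * q \<and> trans_map Gm_system n p (fibre_elem n z) = trans_map Gm_system t q b"
    using assms by (intro exI[of _ t] exI[of _ n] conjI) (simp_all add: trans_map_fibre_elem mult.commute)
  with * show "(t, b) \<in> lim_class Gm_system n (fibre_elem n z)"
    by (auto simp: lim_class_def fibre_alg_carrier Bex_def)
qed

lemma lim_elem_memD: "(n, b) \<in> lim_elem z \<Longrightarrow> n > 0 \<and> z \<in> range (at_root n) \<and> b = fibre_elem n z"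
  by (auto simp: lim_elem_def)

text \<open>
  The operations of the limit are unions over all representatives at a common level. The union is
  over a nonempty family in which only one set occurs.
\<close>

lemma Union_eq_common_value:
  assumes "x \<in> C" "\<And>x. x \<in> C \<Longrightarrow> x = c"
  shows "\<Union>C = c"
  using assms by blast

lemma inj_lim_elem: "inj lim_elem"
proof (rule injI)
  fix z w assume eq: "lim_elem z = lim_elem w"
  obtain n where n: "n > 0" "z \<in> range (at_root n)" by (rule at_root_common)
  then have "(n, fibre_elem n z) \<in> lim_elem z" by (simp add: lim_elem_def)
  with eq have "(n, fibre_elem n z) \<in> lim_elem w" by simp
  then have "w \<in> range (at_root n)" "fibre_elem n z = fibre_elem n w" by (auto dest: lim_elem_memD simp del: vimage_singleton_eq)
  then show "z = w" by (rule inj_onD[OF inj_on_fibre_elem _ n(2), rotated])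
qed

lemma lim_alg_smult: "k \<odot>\<^bsub>lim_alg Gm_system\<^esub> lim_elem z = lim_elem (Poly_Mapping.single 0 k * z)"
proof -
  obtain n where n: "n > 0" "z \<in> range (at_root n)" by (rule at_root_common)
  have class_eq: "lim_class Gm_system s (k \<odot>\<^bsub>fibre_alg Gm_system s\<^esub> a) = lim_elem (Poly_Mapping.single 0 k * z)"
    if "(s, a) \<in> lim_elem z" for s a
  proof -
    have *: "s > 0" "z \<in> range (at_root s)" "a = fibre_elem s z" using lim_elem_memD[OF that] by auto
    then obtain f where "z = at_root s f" by blast
    then have "Poly_Mapping.single 0 k * z = at_root s (Poly_Mapping.single 0 k * f)"
      by (simp add: at_root_mult)
    then show ?thesis using * by (simp add: fibre_alg_smult lim_class_fibre_elem del: vimage_singleton_eq)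
  qed
  have mem: "(n, fibre_elem n z) \<in> lim_elem z" using n by (auto simp: lim_elem_def)
  have "k \<odot>\<^bsub>lim_alg Gm_system\<^esub> lim_elem z =
      \<Union>{lim_class Gm_system s (k \<odot>\<^bsub>fibre_alg Gm_system s\<^esub> a) | s a. (s, a) \<in> lim_elem z}"
    by (simp add: lim_alg_def)
  also have "\<dots> = lim_elem (Poly_Mapping.single 0 k * z)"
  proof (rule Union_eq_common_value)
    show "lim_class Gm_system n (k \<odot>\<^bsub>fibre_alg Gm_system n\<^esub> fibre_elem n z) \<in>
        {lim_class Gm_system s (k \<odot>\<^bsub>fibre_alg Gm_system s\<^esub> a) | s a. (s, a) \<in> lim_elem z}"
      by (intro CollectI exI conjI) (rule refl mem)+
  qed (auto dest: class_eq)
  finally show ?thesis .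
qed

lemma lim_alg_parametrised: "parametrised_ring (lim_alg Gm_system) UNIV lim_elem"
proof
  have class_eq: "lim_class Gm_system s (a \<otimes>\<^bsub>fibre_alg Gm_system s\<^esub> b) = lim_elem (z * w)"
      "lim_class Gm_system s (a \<oplus>\<^bsub>fibre_alg Gm_system s\<^esub> b) = lim_elem (z + w)"
    if "(s, a) \<in> lim_elem z" "(s, b) \<in> lim_elem w" for s a b z w
  proof -
    have *: "s > 0" "z \<in> range (at_root s)" "a = fibre_elem s z" "w \<in> range (at_root s)" "b = fibre_elem s w"
      using lim_elem_memD[OF that(1)] lim_elem_memD[OF that(2)] by auto
    interpret parametrised_ring "fibre_alg Gm_system s" "range (at_root s)" "fibre_elem s"
      by (rule fibre_alg_parametrised[OF *(1)])
    show "lim_class Gm_system s (a \<otimes>\<^bsub>fibre_alg Gm_system s\<^esub> b) = lim_elem (z * w)"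
      "lim_class Gm_system s (a \<oplus>\<^bsub>fibre_alg Gm_system s\<^esub> b) = lim_elem (z + w)"
      using * mult_V[OF *(2,4)] add_V[OF *(2,4)] by (simp_all add: mult_eq add_eq lim_class_fibre_elem)
  qed
  show "carrier (lim_alg Gm_system) = lim_elem ` UNIV"
  proof (intro equalityI subsetI)
    fix U assume "U \<in> carrier (lim_alg Gm_system)"
    then show "U \<in> lim_elem ` UNIV" by (auto simp: lim_alg_def fibre_alg_carrier lim_class_fibre_elem)
  next
    fix U assume "U \<in> lim_elem ` UNIV"
    then obtain z where "U = lim_elem z" by blast
    obtain n where n: "n > 0" "z \<in> range (at_root n)" by (rule at_root_common)
    with \<open>U = lim_elem z\<close> have "U = lim_class Gm_system n (fibre_elem n z)" by (simp add: lim_class_fibre_elem)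
    moreover have "fibre_elem n z \<in> carrier (fibre_alg Gm_system n)"
      using n by (simp add: fibre_alg_carrier)
    ultimately show "U \<in> carrier (lim_alg Gm_system)"
      unfolding lim_alg_def using n(1) by auto
  qed
  interpret one: parametrised_ring "fibre_alg Gm_system 1" "range (at_root 1)" "fibre_elem 1"
    by (rule fibre_alg_parametrised) simp
  show "\<zero>\<^bsub>lim_alg Gm_system\<^esub> = lim_elem 0" "\<one>\<^bsub>lim_alg Gm_system\<^esub> = lim_elem 1"
    using lim_class_fibre_elem[OF _ one.zero_V] lim_class_fibre_elem[OF _ one.one_V]
    by (simp_all add: lim_alg_def one.zero_eq one.one_eq del: One_nat_def)
  fix z w
  obtain n where n: "n > 0" "z \<in> range (at_root n)" "w \<in> range (at_root n)" by (rule at_root_common)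
  then have mem: "(n, fibre_elem n z) \<in> lim_elem z" "(n, fibre_elem n w) \<in> lim_elem w" by (auto simp: lim_elem_def)
  show "lim_elem z \<otimes>\<^bsub>lim_alg Gm_system\<^esub> lim_elem w = lim_elem (z * w)"
  proof -
    have "lim_elem z \<otimes>\<^bsub>lim_alg Gm_system\<^esub> lim_elem w =
        \<Union>{lim_class Gm_system s (a \<otimes>\<^bsub>fibre_alg Gm_system s\<^esub> b) | s a b. (s, a) \<in> lim_elem z \<and> (s, b) \<in> lim_elem w}"
      by (simp add: lim_alg_def)
    also have "\<dots> = lim_elem (z * w)"
    proof (rule Union_eq_common_value)
      show "lim_class Gm_system n (fibre_elem n z \<otimes>\<^bsub>fibre_alg Gm_system n\<^esub> fibre_elem n w) \<in> {lim_class Gm_system s (a \<otimes>\<^bsub>fibre_alg Gm_system s\<^esub> b) | s a b. (s, a) \<in> lim_elem z \<and> (s, b) \<in> lim_elem w}"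
        by (intro CollectI exI conjI) (rule refl mem)+
    qed (auto dest: class_eq(1))
    finally show ?thesis .
  qed
  show "lim_elem z \<oplus>\<^bsub>lim_alg Gm_system\<^esub> lim_elem w = lim_elem (z + w)"
  proof -
    have "lim_elem z \<oplus>\<^bsub>lim_alg Gm_system\<^esub> lim_elem w =
        \<Union>{lim_class Gm_system s (a \<oplus>\<^bsub>fibre_alg Gm_system s\<^esub> b) | s a b. (s, a) \<in> lim_elem z \<and> (s, b) \<in> lim_elem w}"
      by (simp add: lim_alg_def)
    also have "\<dots> = lim_elem (z + w)"
    proof (rule Union_eq_common_value)
      show "lim_class Gm_system n (fibre_elem n z \<oplus>\<^bsub>fibre_alg Gm_system n\<^esub> fibre_elem n w) \<in> {lim_class Gm_system s (a \<oplus>\<^bsub>fibre_alg Gm_system s\<^esub> b) | s a b. (s, a) \<in> lim_elem z \<and> (s, b) \<in> lim_elem w}"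
        by (intro CollectI exI conjI) (rule refl mem)+
    qed (auto dest: class_eq(2))
    finally show ?thesis .
  qed
qed (auto simp: inj_lim_elem)

section \<open>The averaging idempotent and the Bost--Connes endomorphisms\<close>

abbreviation dilate :: "nat \<Rightarrow> (rat_mod_int \<Rightarrow>\<^sub>0 rat) \<Rightarrow> (rat_mod_int \<Rightarrow>\<^sub>0 rat)"
  where "dilate n \<equiv> pushforward (multiple n)"

abbreviation avg :: "nat \<Rightarrow> (rat_mod_int \<Rightarrow>\<^sub>0 rat)"
  where "avg n \<equiv> bc_rho_basis n 0"

lemma dilate_mult: "dilate n (z * w) = dilate n z * dilate n w"
  by (rule pushforward_mult) (rule multiple_add)

lemma dilate_at_root: "n > 0 \<Longrightarrow> dilate n (at_root (n * u) f) = at_root u f"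
  by (simp add: pushforward_pushforward comp_def multiple_ratio_cancel)

lemma surj_dilate:
  assumes "n > 0"
  shows "surj (dilate n)"
proof -
  have "z \<in> range (dilate n)" for z
  proof -
    obtain u where "z \<in> range (at_root (1 * u))" by (rule at_root_cover[of 1]) simp
    then obtain f where "z = at_root u f" by auto
    then have "z = dilate n (at_root (n * u) f)" by (simp only: dilate_at_root[OF assms])
    then show ?thesis by blast
  qed
  then show ?thesis by blast
qed

lemma bc_rho_basis_eq:
  "bc_rho_basis n r = Poly_Mapping.single 0 (1 / of_nat n) * (\<Sum>s | multiple n s = r. Poly_Mapping.single s 1)"
  by (simp add: bc_rho_basis_def e_basis_def)

text \<open>
  The solutions of \<open>ns = nr\<close> are the translates by \<open>r\<close> of the solutions of \<open>nt = 0\<close>.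
\<close>

lemma bc_rho_basis_multiple:
  "bc_rho_basis n (multiple n r) = Poly_Mapping.single r 1 * avg n"
proof -
  have "(\<Sum>s | multiple n s = multiple n r. Poly_Mapping.single s (1::rat)) =
      (\<Sum>t | multiple n t = 0. Poly_Mapping.single (r + t) 1)"
    by (rule sum.reindex_bij_witness[of _ "\<lambda>t. r + t" "\<lambda>s. s - r"])
      (simp_all add: sum_subtractf sum.distrib)
  also have "\<dots> = Poly_Mapping.single r 1 * (\<Sum>t | multiple n t = 0. Poly_Mapping.single t 1)"
    by (simp add: sum_distrib_left mult_single)
  finally show ?thesis by (simp add: bc_rho_basis_eq mult.left_commute)
qed

text \<open>
  Translation by \<open>k/n\<close> permutes the \<open>n\<close>-torsion, so \<open>e\<^bsub>k/n\<^esub>\<close> acts on the average as \<open>1\<close> does.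
\<close>

lemma at_root_mult_avg:
  assumes "n > 0"
  shows "at_root n f * avg n = Poly_Mapping.single 0 (augmentation f) * avg n"
proof (induction f rule: poly_mapping_single_induct)
  case (single k c)
  have "multiple n (ratio n k) = 0"
    using torsion_eq[OF assms] ratio_eq_iff[OF assms, of "int n * k" 0] by (simp add: multiple_ratio)
  then have "Poly_Mapping.single (ratio n k) 1 * avg n = avg n"
    using bc_rho_basis_multiple[of n "ratio n k"] by simp
  moreover have "Poly_Mapping.single (ratio n k) c = Poly_Mapping.single 0 c * Poly_Mapping.single (ratio n k) 1"
    by (simp add: mult_single)
  ultimately show ?case by (simp add: mult.assoc)
qed (simp add: single_add ring_distribs)

text \<open>
  The average comes from level \<open>n\<close>: it is the image of \<open>(1 + t + \<dots> + t\<^bsup>n-1\<^esup>)/n\<close>, which has value \<open>1\<close>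
  at the point \<open>1\<close>.
\<close>

lemma avg_eq_at_root:
  assumes "n > 0"
  obtains f where "avg n = at_root n f" "augmentation f = 1"
proof
  let ?f = "Poly_Mapping.single 0 (1 / of_nat n) * (\<Sum>k\<in>{0..<int n}. Poly_Mapping.single k (1::rat))"
  have sum_push: "at_root n (\<Sum>k\<in>S. Poly_Mapping.single k 1) = (\<Sum>k\<in>S. Poly_Mapping.single (ratio n k) 1)"
    and sum_aug: "augmentation (\<Sum>k\<in>S. Poly_Mapping.single k (1::rat)) = of_nat (card S)"
    if "finite S" for S :: "int set"
    using that by (induction, simp_all)
  have "(\<Sum>s | multiple n s = 0. Poly_Mapping.single s (1::rat)) = (\<Sum>k\<in>{0..<int n}. Poly_Mapping.single (ratio n k) 1)"
    by (simp add: torsion_eq[OF assms] sum.reindex[OF inj_on_ratio[OF assms]])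
  then show "avg n = at_root n ?f"
    by (simp add: bc_rho_basis_eq at_root_mult sum_push)
  show "augmentation ?f = 1"
    using assms by (simp add: augmentation_mult sum_aug)
qed

lemma dilate_at_root_same:
  assumes "n > 0"
  shows "dilate n (at_root n f) = Poly_Mapping.single 0 (augmentation f)"
proof (induction f rule: poly_mapping_single_induct)
  case (single k c)
  have "ratio n (int n * k) = 0" using ratio_eq_iff[OF assms, of _ 0] by simp
  then show ?case by (simp add: multiple_ratio)
qed (simp add: single_add)

lemma dilate_avg: "n > 0 \<Longrightarrow> dilate n (avg n) = 1"
  using avg_eq_at_root[of n] dilate_at_root_same[of n] by (metis single_one)

lemma avg_idem: "n > 0 \<Longrightarrow> avg n * avg n = avg n"
  using avg_eq_at_root[of n] at_root_mult_avg[of n] by (metis single_one mult_1)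

text \<open>
  This formula determines \<open>\<rho>\<^sub>n\<close>, since every element is of the form \<open>dilate n f\<close>.
\<close>

lemma bc_rho_dilate: "bc_rho n (dilate n f) = avg n * f"
proof -
  have F: "additive_coeffs (\<lambda>r c. Poly_Mapping.single 0 c * bc_rho_basis n r)"
    by standard (simp_all add: single_add ring_distribs)
  have bc: "bc_rho n = lin_ext (\<lambda>r c. Poly_Mapping.single 0 c * bc_rho_basis n r)"
    by (rule ext) (simp add: bc_rho_def lin_ext_def)
  show ?thesis
  proof (induction f rule: poly_mapping_single_induct)
    case (single r c)
    have "bc_rho n (dilate n (Poly_Mapping.single r c)) = Poly_Mapping.single 0 c * (Poly_Mapping.single r 1 * avg n)"
      by (simp only: pushforward_single bc additive_coeffs.lin_ext_single[OF F] bc_rho_basis_multiple)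
    also have "\<dots> = avg n * Poly_Mapping.single r c"
      by (simp only: mult.assoc[symmetric] mult_single mult.commute[of "avg n"] add_0 mult_1_right)
    finally show ?case .
  qed (simp only: pushforward_add bc additive_coeffs.lin_ext_add[OF F] distrib_left)
qed

lemma dilate_bc_rho:
  assumes "n > 0"
  shows "dilate n (bc_rho n z) = z"
proof -
  obtain w where "z = dilate n w" using surjD[OF surj_dilate[OF assms]] by blast
  moreover have "dilate n (bc_rho n (dilate n w)) = dilate n w"
    by (simp only: bc_rho_dilate dilate_mult dilate_avg[OF assms] mult_1)
  ultimately show ?thesis by simp
qed

section \<open>Complex characters\<close>

text \<open>
  The embedding of \<open>\<rat>/\<int>\<close> in the unit circle; its powers serve as the characters.
\<close>

lift_definition circle :: "rat_mod_int \<Rightarrow> complex" is "\<lambda>x. cis (2 * pi * of_rat x)"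
proof -
  fix a b :: rat assume "a - b \<in> \<int>"
  then obtain k where "a - b = of_int k" by (rule Ints_cases)
  then have "a = b + of_int k" by (simp add: algebra_simps)
  then have "cis (2 * pi * of_rat a) = cis (2 * pi * of_rat b) * cis (2 * pi * of_int k)"
    by (simp add: of_rat_add distrib_left cis_mult[symmetric])
  then show "cis (2 * pi * of_rat a) = cis (2 * pi * of_rat b)" by simp
qed

lemma circle_add: "circle (r + s) = circle r * circle s"
  by transfer (simp add: cis_mult of_rat_add ring_distribs)

lemma circle_zero: "circle 0 = 1"
  by transfer simp

text \<open>
  Faithfulness is what lets the powers of this one character separate the basis elements.
\<close>

lemma circle_eq_1_iff: "circle r = 1 \<longleftrightarrow> r = 0"
proof
  show "circle r = 1 \<Longrightarrow> r = 0"
  proof transfer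
    fix x :: rat assume "cis (2 * pi * of_rat x) = 1"
    then have "cos (2 * pi * of_rat x) = 1" by (metis cis.simps(1) one_complex.simps(1))
    then obtain k :: int where "2 * pi * of_rat x = of_int k * 2 * pi" by (auto simp: cos_one_2pi_int)
    then have "of_rat x = (of_rat (of_int k) :: real)" by simp
    then show "x - 0 \<in> \<int>" unfolding of_rat_eq_iff by simp
  qed
qed (simp add: circle_zero)

definition char_eval :: "nat \<Rightarrow> (rat_mod_int \<Rightarrow>\<^sub>0 rat) \<Rightarrow> complex"
  where "char_eval m = lin_ext (\<lambda>r c. of_rat c * circle r ^ m)"

lemma additive_char: "additive_coeffs (\<lambda>r c. of_rat c * circle r ^ m)"
  by standard (simp_all add: of_rat_add ring_distribs)

lemma char_eval_single: "char_eval m (Poly_Mapping.single r c) = of_rat c * circle r ^ m"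
  unfolding char_eval_def by (rule additive_coeffs.lin_ext_single[OF additive_char])

lemma char_eval_add: "char_eval m (z + w) = char_eval m z + char_eval m w"
  unfolding char_eval_def by (rule additive_coeffs.lin_ext_add[OF additive_char])

lemma char_eval_mult: "char_eval m (z * w) = char_eval m z * char_eval m w"
  unfolding char_eval_def
  by (rule lin_ext_mult[OF additive_char]) (simp add: of_rat_mult circle_add power_mult_distrib)

lemma char_eval_one: "char_eval m 1 = 1"
  using char_eval_single[of m 0 1] by (simp add: circle_zero)

text \<open>
  Orthogonality of characters: for \<open>\<zeta>\<close> an \<open>n\<close>-th root of unity, \<open>1 + \<zeta> + \<dots> + \<zeta>\<^bsup>n-1\<^esup>\<close> is \<open>n\<close> if
  \<open>\<zeta> = 1\<close> and zero otherwise, so only the coefficient of \<open>e\<^sub>0\<close> survives.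
\<close>

lemma sum_char_eval:
  assumes "n > 0"
  shows "(\<Sum>m<n. char_eval m (at_root n f)) = of_nat n * of_rat (Poly_Mapping.lookup (at_root n f) 0)"
proof (induction f rule: poly_mapping_single_induct)
  case (single k c)
  define \<zeta> where "\<zeta> = circle (ratio n k)"
  have "\<zeta> ^ m = circle (multiple m (ratio n k))" for m
    by (induction m) (simp_all add: \<zeta>_def circle_zero circle_add)
  moreover have "ratio n (int n * k) = 0"
    using ratio_eq_iff[OF assms, of _ 0] by simp
  ultimately have "\<zeta> ^ n = 1" by (simp add: multiple_ratio circle_zero)
  then have "(\<Sum>m<n. \<zeta> ^ m) = (if ratio n k = 0 then of_nat n else 0)"
    by (auto simp: sum_gp_strict circle_eq_1_iff \<zeta>_def)
  then show ?case
    by (simp add: char_eval_single sum_distrib_left[symmetric] lookup_single when_def \<zeta>_def[symmetric])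
qed (simp add: char_eval_add sum.distrib lookup_add of_rat_add ring_distribs)

lemma lookup_mult_single:
  "Poly_Mapping.lookup (z * Poly_Mapping.single (- r) 1) 0 = Poly_Mapping.lookup (z :: 'a::ab_group_add \<Rightarrow>\<^sub>0 'k::comm_ring_1) r"
  by (induction z rule: poly_mapping_single_induct)
    (simp_all add: mult_single lookup_single when_def ring_distribs lookup_add)

text \<open>
  Multiplication by \<open>e\<^bsub>-r\<^esub>\<close> moves the coefficient of \<open>e\<^sub>r\<close> to \<open>e\<^sub>0\<close>, where orthogonality detects it.
\<close>

lemma char_eval_separates:
  assumes "\<And>m. char_eval m z = 0"
  shows "z = 0"
proof (rule poly_mapping_eqI)
  fix r
  let ?w = "z * Poly_Mapping.single (- r) 1"
  obtain n where n: "n > 0" "?w \<in> range (at_root n)" by (rule at_root_common)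
  then obtain f where f: "?w = at_root n f" by blast
  have "(\<Sum>m<n. char_eval m ?w) = 0" by (simp add: char_eval_mult assms)
  with sum_char_eval[OF n(1), of f] n(1) f have "Poly_Mapping.lookup ?w 0 = 0" by simp
  then show "Poly_Mapping.lookup z r = Poly_Mapping.lookup 0 r" by (simp add: lookup_mult_single)
qed

text \<open>
  The kernels of the characters are prime, as \<open>\<complex>\<close> is a domain. This is the reducedness of \<open>\<rat>[\<rat>/\<int>]\<close>,
  in the form that makes functions on \<open>X\<close> determined by their values.
\<close>

lemma zero_if_in_all_primes:
  assumes "\<And>x. x \<in> X_space Gm_system \<Longrightarrow> lim_elem z \<in> x"
  shows "z = 0"
proof (rule char_eval_separates)
  fix m
  interpret parametrised_ring "lim_alg Gm_system" UNIV lim_elem by (rule lim_alg_parametrised)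
  have "lim_elem ` {a \<in> UNIV. char_eval m a = 0} \<in> X_space Gm_system"
    unfolding X_space_def Spec_def
    using primeideal_kernel[of "char_eval m"] by (simp add: char_eval_add char_eval_mult char_eval_one)
  from assms[OF this] show "char_eval m z = 0" using inj_lim_elem by (auto dest: injD)
qed

section \<open>The image of \<open>\<beta>\<^sub>n\<close>\<close>

lemma fibre_base_point_eq:
  assumes "n > 0"
  shows "fibre_base_point Gm_system n = fibre_elem n ` {z \<in> range (at_root n). augmentation z = 0}"
  by (auto simp: fibre_base_point_def fibre_coset[OF assms] point_ideal_eq augmentation_pushforward)

lemma xi_eq:
  assumes "n > 0"
  shows "xi Gm_system n x = fibre_elem n ` {z \<in> range (at_root n). lim_elem z \<in> x}"
  by (auto simp: xi_def Spec_map_def fibre_alg_carrier[OF assms] lim_class_fibre_elem[OF assms])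

text \<open>
  The function \<open>e\<^sub>n\<close> has value \<open>1\<close> at the base point, so it is nonzero throughout the component of
  the base point. Conversely \<open>z e\<^sub>n = z(1) e\<^sub>n\<close> for \<open>z\<close> in \<open>A\<^sub>n\<close>; at a prime that does not contain \<open>e\<^sub>n\<close> the
  factor \<open>e\<^sub>n\<close> can be cancelled, so the prime of \<open>A\<^sub>n\<close> below it is the ideal \<open>z(1) = 0\<close> of the base point.
\<close>

lemma X_idem_eq:
  assumes "n > 0"
  shows "X_idem Gm_system n = {x \<in> X_space Gm_system. lim_elem (avg n) \<notin> x}"
proof -
  interpret A: parametrised_ring "lim_alg Gm_system" UNIV lim_elem by (rule lim_alg_parametrised)
  interpret F: parametrised_ring "fibre_alg Gm_system n" "range (at_root n)" "fibre_elem n"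
    by (rule fibre_alg_parametrised[OF assms])
  let ?b = "fibre_base_point Gm_system n"
  obtain f where f: "avg n = at_root n f" "augmentation f = 1" by (rule avg_eq_at_root[OF assms])
  then have avg: "avg n \<in> range (at_root n)" "augmentation (avg n) = 1"
    by (auto simp: augmentation_pushforward)
  have mem: "fibre_elem n z \<in> fibre_elem n ` Z \<longleftrightarrow> z \<in> Z" if "z \<in> range (at_root n)" "Z \<subseteq> range (at_root n)" for z Z
    using inj_on_image_mem_iff[OF inj_on_fibre_elem that] .
  have "connected_component_of (zariski (fibre_alg Gm_system n)) ?b (xi Gm_system n x) \<longleftrightarrow> lim_elem (avg n) \<notin> x"
    if "x \<in> X_space Gm_system" for x
  proof
    assume "connected_component_of (zariski (fibre_alg Gm_system n)) ?b (xi Gm_system n x)"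
    then have "fibre_elem n (avg n) \<notin> xi Gm_system n x"
    proof (rule F.idempotent_constant_on_component[OF _ avg(1) avg_idem[OF assms]])
      show "fibre_elem n (avg n) \<notin> ?b"
        unfolding fibre_base_point_eq[OF assms] using avg by (subst mem) auto
    qed
    then show "lim_elem (avg n) \<notin> x"
      unfolding xi_eq[OF assms] using avg(1) by (subst (asm) mem) auto
  next
    have prime: "primeideal x (lim_alg Gm_system)" using that by (simp add: X_space_def Spec_def)
    assume avg_notin: "lim_elem (avg n) \<notin> x"
    have "lim_elem z \<in> x \<longleftrightarrow> augmentation z = 0" if "z \<in> range (at_root n)" for z
    proof -
      have "z * avg n = Poly_Mapping.single 0 (augmentation z) * avg n"
        using that at_root_mult_avg[OF assms] by (auto simp: augmentation_pushforward)
      then have "lim_elem z \<in> x \<longleftrightarrow> lim_elem (Poly_Mapping.single 0 (augmentation z)) \<in> x"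
        using A.prime_mult_iff[OF prime] avg_notin by (metis UNIV_I)
      also have "\<dots> \<longleftrightarrow> augmentation z = 0"
      proof
        (* A nonzero constant is a unit and lies in no prime. *)
        assume *: "lim_elem (Poly_Mapping.single 0 (augmentation z)) \<in> x"
        show "augmentation z = 0"
        proof (rule ccontr)
          assume "augmentation z \<noteq> 0"
          then have "Poly_Mapping.single 0 (augmentation z) * Poly_Mapping.single 0 (1 / augmentation z) =
              (1 :: rat_mod_int \<Rightarrow>\<^sub>0 rat)"
            by (simp add: mult_single)
          with * A.prime_mult_iff[OF prime] A.prime_one[OF prime] show False by (metis UNIV_I)
        qed
      qed (simp add: A.prime_zero[OF prime])
      finally show ?thesis .
    qed
    then have "xi Gm_system n x = ?b"
      unfolding xi_eq[OF assms] fibre_base_point_eq[OF assms] by (intro arg_cong[of _ _ "image _"]) auto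
    moreover have "?b \<in> Spec (fibre_alg Gm_system n)"
      unfolding Spec_def fibre_base_point_eq[OF assms]
      using F.primeideal_kernel[of augmentation] by (simp add: augmentation_mult)
    ultimately show "connected_component_of (zariski (fibre_alg Gm_system n)) ?b (xi Gm_system n x)"
      by (simp add: connected_component_of_refl F.topspace_zariski)
  qed
  then show ?thesis by (auto simp: X_idem_def)
qed

section \<open>The endomorphisms \<open>\<beta>\<^sub>n\<close> and \<open>\<rho>\<^sub>n\<close>\<close>

lemma xi_comorphism_eq: "n > 0 \<Longrightarrow> xi_comorphism Gm_system n f = lim_elem (at_root n f)"
  by (simp add: xi_comorphism_def fibre_coset lim_class_fibre_elem)

text \<open>
  The condition on the \<open>\<xi>\<close> forces the comorphism to be \<open>dilate n\<close>, because every element of \<open>A\<close> comes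
  from a level divisible by \<open>n\<close>. Conversely \<open>dilate n\<close> is an isomorphism from the ideal generated by
  \<open>avg n\<close>: it is onto and sends \<open>avg n\<close> to \<open>1\<close>, and \<open>bc_rho n\<close> recovers \<open>avg n * u\<close> from \<open>dilate n u\<close>.
\<close>

lemma beta_lim_elem:
  assumes "n > 0"
  shows "beta Gm_system n (lim_elem z) = lim_elem (dilate n z)"
proof -
  interpret A: parametrised_ring "lim_alg Gm_system" UNIV lim_elem by (rule lim_alg_parametrised)
  let ?A = "lim_alg Gm_system"
  define h where "h = restrict (\<lambda>U. lim_elem (dilate n (inv_into UNIV lim_elem U))) (carrier ?A)"
  have h: "h (lim_elem w) = lim_elem (dilate n w)" for w
    by (simp add: h_def A.carrier_eq inj_lim_elem)
  have "beta Gm_system n = h"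
    unfolding beta_def
  proof (rule the_equality, intro conjI ballI)
    show "h \<in> extensional (carrier ?A)" by (simp add: h_def)
    have hom: "h \<in> alg_hom (base Gm_system) ?A ?A"
      unfolding alg_hom_def
    proof (intro CollectI conjI ballI)
      show "h \<in> ring_hom ?A ?A"
      proof (rule ring_hom_memI)
        have "dilate n 1 = 1" by (metis pushforward_single single_one sum.neutral_const)
        then show "h \<one>\<^bsub>?A\<^esub> = \<one>\<^bsub>?A\<^esub>" by (simp add: A.one_eq h)
      qed (auto simp: A.carrier_eq h A.mult_eq A.add_eq dilate_mult)
      show "h (k \<odot>\<^bsub>?A\<^esub> a) = k \<odot>\<^bsub>?A\<^esub> h a" if "a \<in> carrier ?A" for k a
        using that by (auto simp: A.carrier_eq lim_alg_smult h dilate_mult)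
    qed
    have "inj_on h ((\<lambda>a. lim_elem (avg n) \<otimes>\<^bsub>?A\<^esub> a) ` carrier ?A)"
    proof (rule inj_onI)
      fix U W assume "U \<in> (\<lambda>a. lim_elem (avg n) \<otimes>\<^bsub>?A\<^esub> a) ` carrier ?A"
        "W \<in> (\<lambda>a. lim_elem (avg n) \<otimes>\<^bsub>?A\<^esub> a) ` carrier ?A" and eq: "h U = h W"
      then obtain u w where U: "U = lim_elem (avg n * u)" and W: "W = lim_elem (avg n * w)"
        by (auto simp: A.carrier_eq A.mult_eq)
      from eq have "dilate n u = dilate n w"
        using injD[OF inj_lim_elem] by (simp add: U W h dilate_mult dilate_avg[OF assms])
      then have "avg n * u = avg n * w" by (metis bc_rho_dilate)
      then show "U = W" by (simp add: U W)
    qed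
    moreover have "h ` ((\<lambda>a. lim_elem (avg n) \<otimes>\<^bsub>?A\<^esub> a) ` carrier ?A) = carrier ?A"
    proof -
      have "h ` ((\<lambda>a. lim_elem (avg n) \<otimes>\<^bsub>?A\<^esub> a) ` carrier ?A) = range (\<lambda>w. lim_elem (dilate n w))"
        by (simp add: A.carrier_eq image_image A.mult_eq h dilate_mult dilate_avg[OF assms])
      also have "\<dots> = lim_elem ` range (dilate n)" by (simp only: image_image)
      also have "\<dots> = range lim_elem" by (simp only: surj_dilate[OF assms])
      finally show ?thesis by (simp add: A.carrier_eq)
    qed
    ultimately show "iso_onto_clopen (base Gm_system) ?A (X_idem Gm_system n) h"
      unfolding iso_onto_clopen_def using hom
      by (intro conjI bexI[of _ "lim_elem (avg n)"])
        (simp_all add: A.carrier_eq A.mult_eq avg_idem[OF assms] X_idem_eq[OF assms] X_space_def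
          h dilate_avg[OF assms] A.one_eq bij_betw_def)
    show "h (xi_comorphism Gm_system (n \<otimes>\<^bsub>semigrp Gm_system\<^esub> u) f) = xi_comorphism Gm_system u f"
      if "u \<in> carrier (semigrp Gm_system)" for u f
      using that assms by (simp add: xi_comorphism_eq h dilate_at_root)
  next
    fix g assume g: "g \<in> extensional (carrier ?A) \<and>
      iso_onto_clopen (base Gm_system) ?A (X_idem Gm_system n) g \<and>
      (\<forall>u\<in>carrier (semigrp Gm_system). \<forall>f\<in>carrier (coord Gm_system).
        g (xi_comorphism Gm_system (n \<otimes>\<^bsub>semigrp Gm_system\<^esub> u) f) = xi_comorphism Gm_system u f)"
    show "g = h"
    proof (rule extensionalityI)
      fix U assume "U \<in> carrier ?A"
      then obtain w where "U = lim_elem w" by (auto simp: A.carrier_eq)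
      moreover obtain u where u: "u > 0" "w \<in> range (at_root (n * u))" by (rule at_root_cover[OF assms])
      moreover from u obtain f where f: "w = at_root (n * u) f" by blast
      moreover have "g (xi_comorphism Gm_system (n * u) f) = xi_comorphism Gm_system u f"
        using g u(1) by simp
      ultimately show "g U = h U"
        using u(1) assms by (simp add: xi_comorphism_eq h dilate_at_root)
    qed (use g in \<open>simp_all add: h_def\<close>)
  qed
  then show ?thesis by (simp add: h)
qed

text \<open>
  If \<open>v\<close> has the prescribed values, then \<open>dilate n v = z\<close> since values determine functions, and
  \<open>v(1 - e\<^sub>n)\<close> vanishes everywhere, once because of \<open>v\<close> and once because of \<open>1 - e\<^sub>n\<close>. So
  \<open>v = e\<^sub>n v = bc_rho n (dilate n v) = bc_rho n z\<close>.
\<close>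

lemma rho_lim_elem:
  assumes "n > 0"
  shows "rho Gm_system n (lim_elem z) = lim_elem (bc_rho n z)"
proof -
  interpret A: parametrised_ring "lim_alg Gm_system" UNIV lim_elem by (rule lim_alg_parametrised)
  let ?A = "lim_alg Gm_system"
  have prime: "primeideal x ?A" if "x \<in> X_space Gm_system" for x
    using that by (simp add: X_space_def Spec_def)
  have value_eq: "fun_value ?A (lim_elem a) x = fun_value ?A (lim_elem b) x \<longleftrightarrow> lim_elem (a - b) \<in> x"
    if "x \<in> X_space Gm_system" for x a b
    using A.fun_value_eq_iff[OF primeideal.axioms(1)[OF prime[OF that]]] by simp
  show ?thesis
    unfolding rho_def
  proof (rule the_equality, intro conjI ballI)
    show "lim_elem (bc_rho n z) \<in> carrier ?A" by (simp add: A.carrier_eq)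
    show "fun_value ?A (beta Gm_system n (lim_elem (bc_rho n z))) y = fun_value ?A (lim_elem z) y"
      if "y \<in> X_space Gm_system" for y
      by (simp add: beta_lim_elem[OF assms] dilate_bc_rho[OF assms])
    fix x assume x: "x \<in> X_space Gm_system - X_idem Gm_system n"
    then have x': "x \<in> X_space Gm_system" "lim_elem (avg n) \<in> x" by (auto simp: X_idem_eq[OF assms])
    obtain w where "z = dilate n w" using surjD[OF surj_dilate[OF assms]] by blast
    then have "bc_rho n z = avg n * w" by (simp only: bc_rho_dilate)
    with A.prime_mult_iff[OF prime[OF x'(1)], of "avg n" w] x'
    show "fun_value ?A (lim_elem (bc_rho n z)) x = fun_value ?A \<zero>\<^bsub>?A\<^esub> x"
      by (simp add: A.zero_eq value_eq)
  next
    fix g assume g: "g \<in> carrier ?A \<and>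
      (\<forall>y\<in>X_space Gm_system. fun_value ?A (beta Gm_system n g) y = fun_value ?A (lim_elem z) y) \<and>
      (\<forall>x\<in>X_space Gm_system - X_idem Gm_system n. fun_value ?A g x = fun_value ?A \<zero>\<^bsub>?A\<^esub> x)"
    then obtain v where v: "g = lim_elem v" by (auto simp: A.carrier_eq)
    have "dilate n v - z = 0"
      by (rule zero_if_in_all_primes) (use g v value_eq beta_lim_elem[OF assms] in auto)
    moreover have "v * (1 - avg n) = 0"
    proof (rule zero_if_in_all_primes)
      fix x assume x: "x \<in> X_space Gm_system"
      show "lim_elem (v * (1 - avg n)) \<in> x"
      proof (cases "x \<in> X_idem Gm_system n")
        case True
        then have "lim_elem (1 - avg n) \<in> x"
          using A.prime_complement_iff[OF prime[OF x] _ avg_idem[OF assms]] by (simp add: X_idem_eq[OF assms])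
        then show ?thesis using A.prime_mult_iff[OF prime[OF x]] by blast
      next
        case False
        then have "lim_elem v \<in> x" using g x value_eq[OF x, of v 0] by (auto simp: v A.zero_eq)
        then show ?thesis using A.prime_mult_iff[OF prime[OF x]] by blast
      qed
    qed
    ultimately have "dilate n v = z" "v = avg n * v" by (simp_all add: algebra_simps)
    then show "g = lim_elem (bc_rho n z)" using v bc_rho_dilate by metis
  qed
qed

theorem proposition3p7:
  shows "\<exists>\<phi> \<in> alg_iso (ring_of_type_algebra :: rat ring) (lim_alg Gm_system)
             (monoid_alg :: (rat, rat_mod_int \<Rightarrow>\<^sub>0 rat) module).
           \<forall>n>0. \<forall>a \<in> carrier (lim_alg Gm_system).
             \<phi> (rho Gm_system n a) = bc_rho n (\<phi> a)"
proof
  interpret A: parametrised_ring "lim_alg Gm_system" UNIV lim_elem by (rule lim_alg_parametrised)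
  have inv [simp]: "inv_into UNIV lim_elem (lim_elem z) = z" for z by (simp add: inj_lim_elem)
  show "\<forall>n>0. \<forall>a \<in> carrier (lim_alg Gm_system). inv_into UNIV lim_elem (rho Gm_system n a) = bc_rho n (inv_into UNIV lim_elem a)"
    by (auto simp: A.carrier_eq rho_lim_elem)
  have "inv_into UNIV lim_elem \<in> ring_hom (lim_alg Gm_system) monoid_alg"
    by (rule ring_hom_memI) (auto simp: A.carrier_eq A.mult_eq A.add_eq A.one_eq)
  moreover have "bij_betw (inv_into UNIV lim_elem) (carrier (lim_alg Gm_system)) UNIV"
    by (simp add: A.carrier_eq inj_lim_elem bij_betw_inv_into inj_imp_bij_betw_inv)
  ultimately show "inv_into UNIV lim_elem \<in> alg_iso ring_of_type_algebra (lim_alg Gm_system) monoid_alg"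
    by (auto simp: alg_iso_def alg_hom_def A.carrier_eq lim_alg_smult)
qed

end
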